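(* Let $w=(w_k)_{k\ge0}$ be any weight sequence with $w_0>0$ and $w_k>0$ for some $k\ge1$. Suppose that $n\to\infty$ and $m=m(n)$ with $m/n\to\lambda$, where $0\le\lambda<\omega$. (i) If $\lambda\le\nu$, let $\tau$ be the unique number in $[0,\rho]$ such that $\Psi(\tau)=\lambda$. (ii) If $\lambda>\nu$, let $\tau=\rho$. In both cases $0\le\tau<\infty$ and $0<\Phi(\tau)<\infty$. Let $\pi_k=w_k\tau^k/\Phi(\tau)$, $k\ge0$. Then $(\pi_k)_{k\ge0}$ is a probability distribution with expectation $\mu=\Psi(\tau)=\min(\lambda,\nu)$ and variance $\sigma^2=\tau\Psi'(\tau)\le\infty$. Moreover, for every $k\ge0$, $N_k(B_{m,n})/n\to\pi_k$ in probability.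
   Context: A weight sequence is a sequence $w=(w_k)_{k\ge0}$ of nonnegative reals; $\omega=\sup\{k:w_k>0\}\le\infty$. $\Phi(t)=\sum_{k\ge0}w_kt^k$, $\rho\in[0,\infty]$ its radius of convergence; for $t$ with $\Phi(t)<\infty$, $\Psi(t)=t\Phi'(t)/\Phi(t)=\sum_kkw_kt^k/\sum_kw_kt^k$; if $\Phi(\rho)=\infty$, $\Psi(\rho)=\lim_{t\uparrow\rho}\Psi(t)$; $\nu=\Psi(\rho)$; at $\tau=\rho$, $\Psi'(\tau)$ means $\lim_{s\uparrow\rho}\Psi'(s)$. Convention $0^0=1$. Balls-in-boxes: for integers $m\ge0,n\ge1$ let $\mathcal B_{m,n}=\{(y_1,\dots,y_n)\in\{0,1,2,\dots\}^n:\sum_iy_i=m\}$, with weight $w(y)=\prod_{i=1}^nw_{y_i}$ and $Z(m,n)=\sum_{y\in\mathcal B_{m,n}}w(y)$. When $Z(m,n)>0$, $B_{m,n}=(Y_1,\dots,Y_n)$ is the random element of $\mathcal B_{m,n}$ with $P(B_{m,n}=y)=w(y)/Z(m,n)$ (limit statements are along $n$ with $Z(m,n)>0$). $N_k(y)=|\{i:y_i=k\}|$. *)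

theory Defs
  imports "HOL-Analysis.Analysis"
begin

text \<open>Weight sequences are functions w :: nat => real with nonnegative values.\<close>

definition omega_w :: "(nat \<Rightarrow> real) \<Rightarrow> ereal" where
  "omega_w w = Sup ((\<lambda>k. ereal (real k)) ` {k. w k > 0})"

text \<open>Phi(t) (meaningful when the series converges).\<close>
definition Phi :: "(nat \<Rightarrow> real) \<Rightarrow> real \<Rightarrow> real" where
  "Phi w t = (\<Sum>k. w k * t ^ k)"

text \<open>Psi(t) = t Phi'(t)/Phi(t) as a real function (used for t < rho).\<close>
definition Psi :: "(nat \<Rightarrow> real) \<Rightarrow> real \<Rightarrow> real" where
  "Psi w t = (\<Sum>k. real k * w k * t ^ k) / Phi w t"

definition Psi_at :: "(nat \<Rightarrow> real) \<Rightarrow> real \<Rightarrow> ereal" where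
  "Psi_at w t = (if summable (\<lambda>k. w k * t ^ k)
     then (\<Sum>k. ereal (real k * w k * t ^ k)) / ereal (Phi w t)
     else Lim (at_left t) (\<lambda>s. ereal (Psi w s)))"

definition nu_w :: "(nat \<Rightarrow> real) \<Rightarrow> ereal" where
  "nu_w w = (if conv_radius w = \<infinity> then Lim at_top (\<lambda>s. ereal (Psi w s))
             else Psi_at w (real_of_ereal (conv_radius w)))"

definition PsiD :: "(nat \<Rightarrow> real) \<Rightarrow> real \<Rightarrow> ereal" where
  "PsiD w t = (if ereal t < conv_radius w then ereal (deriv (Psi w) t)
     else Lim (at_left t) (\<lambda>s. ereal (deriv (Psi w) s)))"

text \<open>Balls-in-boxes configurations (y_1..y_n) encoded as y :: nat => nat with y i = 0 for i >= n
  (indices 0..n-1).\<close>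
definition BB :: "nat \<Rightarrow> nat \<Rightarrow> (nat \<Rightarrow> nat) set" where
  "BB m n = {y. (\<forall>i\<ge>n. y i = 0) \<and> (\<Sum>i<n. y i) = m}"

definition wt :: "(nat \<Rightarrow> real) \<Rightarrow> nat \<Rightarrow> (nat \<Rightarrow> nat) \<Rightarrow> real" where
  "wt w n y = (\<Prod>i<n. w (y i))"

definition Zmn :: "(nat \<Rightarrow> real) \<Rightarrow> nat \<Rightarrow> nat \<Rightarrow> real" where
  "Zmn w m n = (\<Sum>y\<in>BB m n. wt w n y)"

definition prob_BB :: "(nat \<Rightarrow> real) \<Rightarrow> nat \<Rightarrow> nat \<Rightarrow> ((nat \<Rightarrow> nat) \<Rightarrow> bool) \<Rightarrow> real" where
  "prob_BB w m n P = (\<Sum>y\<in>{y\<in>BB m n. P y}. wt w n y) / Zmn w m n"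

definition Ncount :: "nat \<Rightarrow> nat \<Rightarrow> (nat \<Rightarrow> nat) \<Rightarrow> nat" where
  "Ncount n k y = card {i. i < n \<and> y i = k}"

end

theory Submission
  imports Defs "HOL-Computational_Algebra.Polynomial_FPS" "HOL-Real_Asymp.Real_Asymp"
begin

text \<open>
  The case \<open>\<tau> > 0\<close> is a large deviation estimate. Replacing \<open>w\<close> by the weights \<open>\<pi>\<close> does not change the law of
  \<open>B\<^sub>m\<^sub>,\<^sub>n\<close>. For probability weights Chernoff's bound gives \<open>Z(m,n)\<close> times the probability of
  \<open>\<bar>N\<^sub>k / n - \<pi>\<^sub>k\<bar> > \<epsilon>\<close> an exponentially small bound, because \<open>Z\<close> for the weights with \<open>\<pi>\<^sub>k\<close> multiplied
  by \<open>c\<close> is at most \<open>(1 + (c - 1) \<pi>\<^sub>k)\<^sup>n\<close>. So it suffices that \<open>Z(m,n)\<close> itself, when positive, is not exponentially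
  small. Truncate \<open>\<pi>\<close> at \<open>K\<close> and tilt it to mean \<open>l\<close>; the normalising constant of the tilt tends to \<open>1\<close> as
  \<open>K\<close> grows, since either \<open>\<pi>\<close> has mean \<open>l\<close> or \<open>\<pi>\<close> has no exponential moment. The law of large numbers for the tilted
  weights yields some \<open>m'\<close> near \<open>l n'\<close> with large \<open>Z(m',n')\<close>, where \<open>n'\<close> is slightly less than \<open>n\<close>, and the
  remaining \<open>n - n'\<close> boxes absorb the difference \<open>m - m'\<close>.

  If \<open>\<tau> = 0\<close>, then \<open>l = 0\<close>, where \<open>N\<^sub>k \<le> m\<close> for \<open>k \<ge> 1\<close> suffices, or the radius of convergence is \<open>0\<close>. In the
  latter case there are arbitrarily heavy weights \<open>w\<^sub>q\<close>, and exchanging boxes with \<open>k\<close> balls for a few boxes with \<open>q\<close> balls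
  and empty ones shows that boxes with \<open>k \<ge> 1\<close> balls are rare.
\<close>

section \<open>Partition functions\<close>

lemma finite_BB: "finite (BB m n)"
proof (rule finite_subset)
  show "BB m n \<subseteq> {y. \<forall>i. (i \<in> {..<n} \<longrightarrow> y i \<in> {..m}) \<and> (i \<notin> {..<n} \<longrightarrow> y i = 0)}"
  proof
    fix y assume y: "y \<in> BB m n"
    have "y i \<le> m" if "i < n" for i
      using y member_le_sum[of i "{..<n}" y] that by (auto simp: BB_def)
    with y show "y \<in> {y. \<forall>i. (i \<in> {..<n} \<longrightarrow> y i \<in> {..m}) \<and> (i \<notin> {..<n} \<longrightarrow> y i = 0)}"
      by (auto simp: BB_def)
  qed
  show "finite {y. \<forall>i. (i \<in> {..<n} \<longrightarrow> y i \<in> {..m}) \<and> (i \<notin> {..<n} \<longrightarrow> y i = (0::nat))}"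
    by (rule finite_set_of_finite_funs) auto
qed

lemma Zmn_0: "Zmn w m 0 = (if m = 0 then 1 else 0)"
proof -
  have "BB m 0 = (if m = 0 then {\<lambda>_. 0} else {})"
    by (auto simp: BB_def)
  then show ?thesis
    by (simp add: Zmn_def wt_def)
qed

text \<open>Split off the last box. In the bijection its entry is reset to 0, since the encoding
  requires configurations to vanish from index \<open>n\<close> on.\<close>

lemma Zmn_Suc: "Zmn w m (Suc n) = (\<Sum>i=0..m. w i * Zmn w (m - i) n)"
proof -
  have "(\<Sum>i=0..m. w i * Zmn w (m - i) n)
      = (\<Sum>(i, y)\<in>Sigma {0..m} (\<lambda>i. BB (m - i) n). w i * wt w n y)"
    by (simp add: Zmn_def sum_distrib_left sum.Sigma finite_BB)
  also have "\<dots> = (\<Sum>y\<in>BB m (Suc n). wt w (Suc n) y)"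
    by (rule sum.reindex_bij_witness[where i = "\<lambda>y. (y n, y(n := 0))" and j = "\<lambda>(i, y). y(n := i)"])
       (auto simp: BB_def wt_def fun_eq_iff)
  finally show ?thesis by (simp add: Zmn_def)
qed

text \<open>Multiplying power series convolves coefficients, exactly as adding boxes convolves
  partition functions. Superadditivity, tilted sums and binomial expansions thus become identities
  between power series.\<close>

lemma Zmn_eq_fps_nth: "Zmn w m n = fps_nth (Abs_fps w ^ n) m"
proof (induction n arbitrary: m)
  case 0
  then show ?case by (simp add: Zmn_0)
next
  case (Suc n)
  then show ?case by (simp add: Zmn_Suc fps_mult_nth)
qed

lemma wt_nonneg: "(\<And>k. w k \<ge> 0) \<Longrightarrow> wt w n y \<ge> 0"
  by (simp add: wt_def prod_nonneg)

lemma Zmn_nonneg: "(\<And>k. w k \<ge> 0) \<Longrightarrow> Zmn w m n \<ge> 0"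
  by (simp add: Zmn_def sum_nonneg wt_nonneg)

lemma Zmn_mono:
  assumes "\<And>k. 0 \<le> v k" "\<And>k. v k \<le> w k"
  shows "Zmn v m n \<le> Zmn w m n"
  unfolding Zmn_def wt_def using assms by (intro sum_mono prod_mono) auto

text \<open>Configurations of \<open>p\<close> and of \<open>q\<close> boxes can be concatenated; in
  the Cauchy product this is one nonnegative term. The lower bounds below are obtained by gluing
  blocks in this way.\<close>

lemma Zmn_superadditive:
  assumes "\<And>k. w k \<ge> 0"
  shows "Zmn w a p * Zmn w b q \<le> Zmn w (a + b) (p + q)"
proof -
  have "Zmn w (a + b) (p + q) = (\<Sum>i=0..a+b. Zmn w i p * Zmn w (a + b - i) q)"
    by (simp add: Zmn_eq_fps_nth power_add fps_mult_nth)
  also have "\<dots> \<ge> Zmn w a p * Zmn w (a + b - a) q"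
    by (rule member_le_sum) (auto simp: Zmn_nonneg assms)
  finally show ?thesis by simp
qed

lemma Zmn_1: "Zmn w k (Suc 0) = w k"
  by (simp add: Zmn_eq_fps_nth)

lemma Zmn_replicate:
  assumes "\<And>k. w k \<ge> 0"
  shows "w k ^ j \<le> Zmn w (j * k) j"
proof (induction j)
  case 0
  then show ?case by (simp add: Zmn_0)
next
  case (Suc j)
  have "w k ^ Suc j \<le> Zmn w k (Suc 0) * Zmn w (j * k) j"
    using Suc assms by (simp add: Zmn_1 mult_left_mono)
  also have "\<dots> \<le> Zmn w (k + j * k) (Suc 0 + j)"
    by (rule Zmn_superadditive[OF assms])
  finally show ?case by simp
qed

text \<open>Dropping the constraint on the number of balls leaves a product of \<open>n\<close>
  independent sums.\<close>

lemma Zmn_le_power_suminf: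
  assumes "\<And>k. w k \<ge> 0" "summable w"
  shows "Zmn w m n \<le> suminf w ^ n"
proof (induction n arbitrary: m)
  case 0
  then show ?case by (simp add: Zmn_0)
next
  case (Suc n)
  have s: "suminf w \<ge> 0" using assms by (simp add: suminf_nonneg)
  have "Zmn w m (Suc n) \<le> (\<Sum>i=0..m. w i * suminf w ^ n)"
    unfolding Zmn_Suc by (intro sum_mono mult_left_mono Suc assms)
  also have "\<dots> = (\<Sum>i=0..m. w i) * suminf w ^ n" by (simp add: sum_distrib_right)
  also have "\<dots> \<le> suminf w * suminf w ^ n"
    by (intro mult_right_mono sum_le_suminf assms) (auto simp: s assms)
  finally show ?case by simp
qed

section \<open>Tilting and generating functions of occupation numbers\<close>

lemma wt_tilt:
  assumes "y \<in> BB m n"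
  shows "wt (\<lambda>k. C * w k * t ^ k) n y = C ^ n * t ^ m * wt w n y"
  using assms by (simp add: wt_def BB_def prod.distrib power_sum[symmetric])

lemma Zmn_tilt: "Zmn (\<lambda>k. C * w k * t ^ k) m n = C ^ n * t ^ m * Zmn w m n"
  unfolding Zmn_def by (simp add: wt_tilt sum_distrib_left)

text \<open>All configurations in \<open>BB m n\<close> have the same number of boxes and of balls,
  so the tilting factor is constant and cancels. This allows \<open>w\<close> to be replaced by the
  probability weights when \<open>\<tau>\<close> is positive.\<close>

lemma prob_BB_tilt:
  assumes "C \<noteq> 0" "t \<noteq> 0"
  shows "prob_BB (\<lambda>k. C * w k * t ^ k) m n P = prob_BB w m n P"
proof -
  have "(\<Sum>y\<in>{y\<in>BB m n. P y}. wt (\<lambda>k. C * w k * t ^ k) n y)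
      = C ^ n * t ^ m * (\<Sum>y\<in>{y\<in>BB m n. P y}. wt w n y)"
    unfolding sum_distrib_left by (rule sum.cong) (auto simp: wt_tilt)
  then show ?thesis using assms by (simp add: prob_BB_def Zmn_tilt)
qed

text \<open>Scaling a single weight turns the partition function into the generating function of
  \<open>Ncount n k\<close>; the exponential tail bounds come from this.\<close>

lemma wt_fun_upd: "wt (w(k := c * w k)) n y = c ^ Ncount n k y * wt w n y"
proof -
  have "wt (w(k := c * w k)) n y = (\<Prod>i<n. (if y i = k then c else 1) * w (y i))"
    unfolding wt_def by (intro prod.cong) auto
  also have "\<dots> = (\<Prod>i<n. (if y i = k then c else 1)) * wt w n y"
    by (simp add: prod.distrib wt_def)
  also have "(\<Prod>i<n. (if y i = k then c else 1)) = c ^ Ncount n k y"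
  proof -
    have "(\<Prod>i<n. (if y i = k then c else 1)) = (\<Prod>i\<in>{i\<in>{..<n}. y i = k}. c)"
      by (rule prod.inter_filter[symmetric]) simp
    then show ?thesis by (simp add: Ncount_def)
  qed
  finally show ?thesis .
qed

lemma prob_BB_mono:
  assumes "\<And>k. w k \<ge> 0" "\<And>y. y \<in> BB m n \<Longrightarrow> P y \<Longrightarrow> Q y"
  shows "prob_BB w m n P \<le> prob_BB w m n Q"
  unfolding prob_BB_def using assms
  by (intro divide_right_mono sum_mono2) (auto simp: finite_BB wt_nonneg Zmn_nonneg)

lemma prob_BB_bex_le:
  assumes "\<And>k. w k \<ge> 0" "finite I"
  shows "prob_BB w m n (\<lambda>y. \<exists>i\<in>I. P i y) \<le> (\<Sum>i\<in>I. prob_BB w m n (P i))"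
proof -
  have restrict: "(\<Sum>y\<in>{y \<in> BB m n. Q y}. wt w n y) = (\<Sum>y\<in>BB m n. if Q y then wt w n y else 0)" for Q
    by (rule sum.inter_filter) (rule finite_BB)
  have "(\<Sum>y\<in>{y \<in> BB m n. \<exists>i\<in>I. P i y}. wt w n y)
      \<le> (\<Sum>y\<in>BB m n. \<Sum>i\<in>I. if P i y then wt w n y else 0)"
    unfolding restrict
  proof (rule sum_mono)
    fix y
    have "wt w n y \<le> (\<Sum>i\<in>I. if P i y then wt w n y else 0)" if "j \<in> I" "P j y" for j
      using member_le_sum[of j I "\<lambda>i. if P i y then wt w n y else 0"] that assms
      by (auto simp: wt_nonneg)
    then show "(if \<exists>i\<in>I. P i y then wt w n y else 0) \<le> (\<Sum>i\<in>I. if P i y then wt w n y else 0)"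
      by (auto intro!: sum_nonneg simp: wt_nonneg assms)
  qed
  also have "\<dots> = (\<Sum>i\<in>I. \<Sum>y\<in>{y \<in> BB m n. P i y}. wt w n y)"
    unfolding restrict by (rule sum.swap)
  finally have "(\<Sum>y\<in>{y \<in> BB m n. \<exists>i\<in>I. P i y}. wt w n y)
      \<le> (\<Sum>i\<in>I. \<Sum>y\<in>{y \<in> BB m n. P i y}. wt w n y)" .
  then show ?thesis
    unfolding prob_BB_def
    by (simp add: sum_divide_distrib[symmetric] divide_right_mono Zmn_nonneg assms(1))
qed

text \<open>Markov's inequality for \<open>c ^ Ncount n k y\<close>. Values of \<open>c\<close>
  above 1 serve the upper tail, values below 1 the lower tail.\<close>

lemma prob_BB_Ncount_markov:
  assumes "\<And>k. w k \<ge> 0" "Zmn w m n > 0"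
    and "\<And>y. y \<in> BB m n \<Longrightarrow> P y \<Longrightarrow> A \<le> c ^ Ncount n k y" "A > 0" "c \<ge> 0"
  shows "prob_BB w m n P \<le> Zmn (w(k := c * w k)) m n / (A * Zmn w m n)"
proof -
  have "A * (\<Sum>y\<in>{y\<in>BB m n. P y}. wt w n y) \<le> (\<Sum>y\<in>{y\<in>BB m n. P y}. c ^ Ncount n k y * wt w n y)"
    unfolding sum_distrib_left using assms by (intro sum_mono mult_right_mono) (auto simp: wt_nonneg)
  also have "\<dots> \<le> (\<Sum>y\<in>BB m n. c ^ Ncount n k y * wt w n y)"
    using assms by (intro sum_mono2) (auto simp: finite_BB wt_nonneg)
  also have "\<dots> = Zmn (w(k := c * w k)) m n" by (simp add: Zmn_def wt_fun_upd)
  finally show ?thesis using assms by (simp add: prob_BB_def field_simps)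
qed

lemma Ncount_times_le:
  assumes "y \<in> BB m n"
  shows "k * Ncount n k y \<le> m"
proof -
  have "k * Ncount n k y = (\<Sum>i\<in>{i. i < n \<and> y i = k}. y i)"
    by (simp add: Ncount_def)
  also have "\<dots> \<le> (\<Sum>i<n. y i)" by (rule sum_mono2) auto
  also have "\<dots> = m" using assms by (simp add: BB_def)
  finally show ?thesis .
qed

lemma Ncount_le: "Ncount n k y \<le> n"
proof -
  have "Ncount n k y \<le> card {..<n}" unfolding Ncount_def by (rule card_mono) auto
  then show ?thesis by simp
qed

text \<open>Boxes with more than \<open>K\<close> balls number at most \<open>m / (K + 1)\<close>;
  multiplying through by \<open>K + 1\<close> keeps the inequality in the natural numbers.\<close>

lemma Ncount_0_ge:
  assumes "y \<in> BB m n"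
  shows "(K + 1) * n \<le> (K + 1) * (Ncount n 0 y + (\<Sum>k=1..K. Ncount n k y)) + m"
proof -
  have "{..<n} = {i. i < n \<and> y i = 0} \<union> (\<Union>k\<in>{1..K}. {i. i < n \<and> y i = k}) \<union> {i. i < n \<and> K < y i}"
    by (auto simp: Suc_le_eq)
  then have "n = card ({i. i < n \<and> y i = 0} \<union> (\<Union>k\<in>{1..K}. {i. i < n \<and> y i = k}) \<union> {i. i < n \<and> K < y i})"
    by (metis card_lessThan)
  also have "\<dots> \<le> card {i. i < n \<and> y i = 0} + card (\<Union>k\<in>{1..K}. {i. i < n \<and> y i = k}) + card {i. i < n \<and> K < y i}"
    using card_Un_le by (meson add_le_mono1 order_trans)
  also have "card (\<Union>k\<in>{1..K}. {i. i < n \<and> y i = k}) \<le> (\<Sum>k=1..K. Ncount n k y)"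
    unfolding Ncount_def by (rule card_UN_le) simp
  finally have "n \<le> Ncount n 0 y + (\<Sum>k=1..K. Ncount n k y) + card {i. i < n \<and> K < y i}"
    by (simp add: Ncount_def)
  then have "(K + 1) * n \<le> (K + 1) * (Ncount n 0 y + (\<Sum>k=1..K. Ncount n k y)) + (K + 1) * card {i. i < n \<and> K < y i}"
    by (metis add_mult_distrib2 mult_le_mono2)
  moreover have "(K + 1) * card {i. i < n \<and> K < y i} \<le> m"
  proof -
    have "(K + 1) * card {i. i < n \<and> K < y i} = (\<Sum>i\<in>{i. i < n \<and> K < y i}. K + 1)" by simp
    also have "\<dots> \<le> (\<Sum>i\<in>{i. i < n \<and> K < y i}. y i)" by (rule sum_mono) auto
    also have "\<dots> \<le> (\<Sum>i<n. y i)" by (rule sum_mono2) auto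
    also have "\<dots> = m" using assms by (simp add: BB_def)
    finally show ?thesis .
  qed
  ultimately show ?thesis by linarith
qed

section \<open>The exponential lower bound\<close>

text \<open>The moment generating function equals 1 at 0 and has a negative derivative there, so it
  drops below 1 just to the right of 0. The Chernoff rates below come from such an
  \<open>s\<close>.\<close>

lemma sum_exp_less_1:
  fixes q c :: "'a \<Rightarrow> real"
  assumes "finite A" "(\<Sum>k\<in>A. q k) = 1" "(\<Sum>k\<in>A. q k * c k) < 0"
  obtains s where "s > 0" "(\<Sum>k\<in>A. q k * exp (s * c k)) < 1"
proof -
  have "((\<lambda>s. \<Sum>k\<in>A. q k * exp (s * c k)) has_real_derivative (\<Sum>k\<in>A. q k * c k)) (at 0)"
    by (auto intro!: derivative_eq_intros simp: mult.commute)
  from DERIV_neg_dec_right[OF this assms(3)] obtain d where "d > 0"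
    "\<And>h. h > 0 \<Longrightarrow> h < d \<Longrightarrow> (\<Sum>k\<in>A. q k * exp (h * c k)) < (\<Sum>k\<in>A. q k)"
    by auto
  then have "(\<Sum>k\<in>A. q k * exp (d / 2 * c k)) < 1" "d / 2 > 0"
    using assms(2) by (metis field_sum_of_halves half_gt_zero less_add_same_cancel1)+
  then show thesis by (rule that[rotated])
qed

text \<open>Finite support turns the generating function into a polynomial, which can be evaluated
  at any real \<open>z\<close>; its degree gives the range of \<open>m\<close>.\<close>

lemma sum_Zmn_times_power:
  assumes "\<And>k. k > K \<Longrightarrow> q k = 0"
  shows "(\<Sum>m\<le>K * n. Zmn q m n * z ^ m) = (\<Sum>k\<le>K. q k * z ^ k) ^ n"
proof -
  define P where "P = (\<Sum>k\<le>K. monom (q k) k)"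
  have cP: "coeff P k = q k" for k
    using assms[of k] by (cases "k \<le> K") (auto simp: P_def coeff_sum)
  have "degree P \<le> K"
    by (rule degree_le) (simp add: cP assms)
  then have deg: "degree (P ^ n) \<le> K * n"
    using degree_power_le[of P n] by (meson le_trans mult_le_mono1)
  have "Abs_fps q = fps_of_poly P"
    by (rule fps_ext) (simp add: cP)
  then have Z: "Zmn q m n = coeff (P ^ n) m" for m
    by (simp add: Zmn_eq_fps_nth fps_of_poly_power[symmetric])
  have "(\<Sum>m\<le>K * n. Zmn q m n * z ^ m) = poly (P ^ n) z"
    unfolding Z poly_altdef using deg
    by (intro sum.mono_neutral_right) (auto simp: coeff_eq_0)
  also have "\<dots> = (\<Sum>k\<le>K. q k * z ^ k) ^ n"
    by (simp add: P_def poly_sum poly_monom poly_power)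
  finally show ?thesis .
qed

text \<open>Chernoff's bound: the factor \<open>exp (a * n + s * m)\<close> is at least 1 on
  \<open>M\<close>, and the sum over all \<open>m\<close> with this factor is an \<open>n\<close>-th
  power.\<close>

lemma Zmn_weighted_sum_le:
  assumes "\<And>k. q k \<ge> 0" "\<And>k. k > K \<Longrightarrow> q k = 0"
    and "\<And>m. m \<in> M \<Longrightarrow> m \<le> K * n \<and> a * real n + s * real m \<ge> 0"
  shows "(\<Sum>m\<in>M. Zmn q m n) \<le> (\<Sum>k\<le>K. q k * exp (s * real k + a)) ^ n"
proof -
  have "(\<Sum>m\<in>M. Zmn q m n) \<le> (\<Sum>m\<in>M. Zmn q m n * exp (a * real n + s * real m))"
  proof (rule sum_mono)
    fix m assume "m \<in> M"
    then have "1 \<le> exp (a * real n + s * real m)" using assms(3) by simp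
    from mult_left_mono[OF this Zmn_nonneg[of q m n, OF assms(1)]]
    show "Zmn q m n \<le> Zmn q m n * exp (a * real n + s * real m)" by simp
  qed
  also have "\<dots> \<le> (\<Sum>m\<le>K * n. Zmn q m n * exp (a * real n + s * real m))"
    using assms by (intro sum_mono2) (auto simp: Zmn_nonneg)
  also have "\<dots> = exp a ^ n * (\<Sum>m\<le>K * n. Zmn q m n * exp s ^ m)"
    by (simp add: exp_add exp_of_nat_mult exp_of_nat2_mult sum_distrib_left mult_ac)
  also have "\<dots> = (\<Sum>k\<le>K. q k * exp (s * real k + a)) ^ n"
    by (simp add: sum_Zmn_times_power[of K q, OF assms(2)] power_mult_distrib[symmetric])
      (simp add: sum_distrib_left exp_add exp_of_nat2_mult mult_ac)
  finally show ?thesis .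
qed

text \<open>Weak law of large numbers. Both tails decay exponentially, so the central values of
  \<open>m\<close> carry more than half of the mass; there are at most \<open>K * n + 1\<close> of
  them, hence one carries at least the average.\<close>

lemma Zmn_concentration:
  fixes q :: "nat \<Rightarrow> real"
  assumes nn: "\<And>k. q k \<ge> 0" and fin: "\<And>k. k > K \<Longrightarrow> q k = 0"
    and tot: "(\<Sum>k\<le>K. q k) = 1" and mean: "(\<Sum>k\<le>K. q k * (real k - l)) = 0" and "\<delta> > 0"
  shows "\<forall>\<^sub>F n in sequentially.
           \<exists>m. \<bar>real m - l * real n\<bar> \<le> \<delta> * real n \<and> 1 / (2 * (real (K * n) + 1)) \<le> Zmn q m n"
proof -
  have "(\<Sum>k\<le>K. q k * (real k - l - \<delta>)) = (\<Sum>k\<le>K. q k * (real k - l)) - \<delta> * (\<Sum>k\<le>K. q k)"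
    by (simp add: sum_subtractf right_diff_distrib sum_distrib_left mult_ac)
  then have "(\<Sum>k\<le>K. q k * (real k - l - \<delta>)) < 0" using mean tot \<open>\<delta> > 0\<close> by simp
  from sum_exp_less_1[OF _ tot this] obtain s
    where s: "s > 0" "(\<Sum>k\<le>K. q k * exp (s * (real k - l - \<delta>))) < 1" by auto
  have "(\<Sum>k\<le>K. q k * (l - real k - \<delta>)) = - (\<Sum>k\<le>K. q k * (real k - l)) - \<delta> * (\<Sum>k\<le>K. q k)"
    by (simp add: sum_subtractf right_diff_distrib sum_distrib_left mult_ac)
  then have "(\<Sum>k\<le>K. q k * (l - real k - \<delta>)) < 0" using mean tot \<open>\<delta> > 0\<close> by simp
  from sum_exp_less_1[OF _ tot this] obtain t
    where t: "t > 0" "(\<Sum>k\<le>K. q k * exp (t * (l - real k - \<delta>))) < 1" by auto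
  define F where "F = (\<Sum>k\<le>K. q k * exp (s * (real k - l - \<delta>)))"
  define H where "H = (\<Sum>k\<le>K. q k * exp (t * (l - real k - \<delta>)))"
  have FH: "0 \<le> F" "F < 1" "0 \<le> H" "H < 1"
    using s t nn by (auto simp: F_def H_def sum_nonneg)
  have ev: "\<forall>\<^sub>F n in sequentially. F ^ n + H ^ n < 1 / 2"
  proof (rule order_tendstoD)
    show "(\<lambda>n. F ^ n + H ^ n) \<longlonglongrightarrow> 0"
      using tendsto_add[OF LIMSEQ_realpow_zero[OF FH(1,2)] LIMSEQ_realpow_zero[OF FH(3,4)]] by simp
  qed simp
  show ?thesis using ev
  proof eventually_elim
    case (elim n)
    define M1 where "M1 = {m. m \<le> K * n \<and> real m > (l + \<delta>) * real n}"
    define M2 where "M2 = {m. m \<le> K * n \<and> real m < (l - \<delta>) * real n}"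
    define M where "M = {m. m \<le> K * n \<and> \<bar>real m - l * real n\<bar> \<le> \<delta> * real n}"
    have "(\<Sum>m\<in>M1. Zmn q m n) \<le> (\<Sum>k\<le>K. q k * exp (s * real k + (- s * (l + \<delta>)))) ^ n"
    proof (rule Zmn_weighted_sum_le[OF nn fin])
      fix m assume "m \<in> M1"
      then have "s * ((l + \<delta>) * real n) \<le> s * real m" "m \<le> K * n"
        using s by (auto simp: M1_def)
      then show "m \<le> K * n \<and> 0 \<le> (- s * (l + \<delta>)) * real n + s * real m"
        by (simp add: algebra_simps)
    qed
    then have b1: "(\<Sum>m\<in>M1. Zmn q m n) \<le> F ^ n" by (simp add: F_def algebra_simps)
    have "(\<Sum>m\<in>M2. Zmn q m n) \<le> (\<Sum>k\<le>K. q k * exp (- t * real k + t * (l - \<delta>))) ^ n"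
    proof (rule Zmn_weighted_sum_le[OF nn fin])
      fix m assume "m \<in> M2"
      then have "t * ((l - \<delta>) * real n) \<ge> t * real m" "m \<le> K * n"
        using t by (auto simp: M2_def)
      then show "m \<le> K * n \<and> 0 \<le> (t * (l - \<delta>)) * real n + - t * real m"
        by (simp add: algebra_simps)
    qed
    then have b2: "(\<Sum>m\<in>M2. Zmn q m n) \<le> H ^ n" by (simp add: H_def algebra_simps)
    have fin3: "finite M" "finite M1" "finite M2" by (auto simp: M_def M1_def M2_def)
    have "1 = (\<Sum>m\<le>K * n. Zmn q m n)"
      using sum_Zmn_times_power[OF fin, where n = n and z = 1] tot by simp
    also have "{..K * n} = M \<union> (M1 \<union> M2)"
      by (auto simp: M_def M1_def M2_def algebra_simps abs_le_iff)
    also have "(\<Sum>m\<in>M \<union> (M1 \<union> M2). Zmn q m n) \<le> (\<Sum>m\<in>M. Zmn q m n) + ((\<Sum>m\<in>M1. Zmn q m n) + (\<Sum>m\<in>M2. Zmn q m n))"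
      \<comment> \<open>Subadditivity by inclusion and exclusion, the sums over the overlaps being
        nonnegative.\<close>
      using fin3 sum.union_inter[of M "M1 \<union> M2" "\<lambda>m. Zmn q m n"] sum.union_inter[of M1 M2 "\<lambda>m. Zmn q m n"]
        sum_nonneg[of "M \<inter> (M1 \<union> M2)" "\<lambda>m. Zmn q m n"] sum_nonneg[of "M1 \<inter> M2" "\<lambda>m. Zmn q m n"]
        Zmn_nonneg[of q, OF nn] by simp
    finally have half: "1 / 2 < (\<Sum>m\<in>M. Zmn q m n)" using b1 b2 elim by linarith
    show ?case
    proof (rule ccontr)
      assume "\<not> ?thesis"
      then have "Zmn q m n \<le> 1 / (2 * (real (K * n) + 1))" if "m \<in> M" for m
        using that by (force simp: M_def)
      then have "(\<Sum>m\<in>M. Zmn q m n) \<le> real (card M) * (1 / (2 * (real (K * n) + 1)))"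
        by (rule sum_bounded_above)
      also have "\<dots> \<le> (real (K * n) + 1) * (1 / (2 * (real (K * n) + 1)))"
      proof (rule mult_right_mono)
        have "card M \<le> card {..K * n}" by (rule card_mono) (auto simp: M_def)
        then have "card M \<le> K * n + 1" by simp
        then show "real (card M) \<le> real (K * n) + 1" by linarith
      qed simp
      also have "\<dots> = 1 / 2"
      proof -
        have "x * (1 / (2 * x)) = 1 / 2" if "x \<noteq> 0" for x :: real using that by simp
        moreover have "real (K * n) + 1 \<noteq> 0" by linarith
        ultimately show ?thesis by blast
      qed
      finally show False using half by simp
    qed
  qed
qed

section \<open>Truncation and tilting to mean \<open>l\<close>\<close>

text \<open>If the mean is \<open>l\<close>, the single terms at \<open>0\<close> and
  \<open>b\<close> are at least 1 for large \<open>\<bar>u\<bar>\<close>, and for bounded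
  \<open>u\<close> the tangent at 0 is almost horizontal. If the mean is smaller, the tangent
  handles \<open>u \<le> 0\<close>, divergence handles \<open>u \<ge> u0\<close>, and the short gap
  between them costs little.\<close>

lemma truncated_exp_moment_ge:
  fixes p :: "nat \<Rightarrow> real"
  assumes nn: "\<And>k. p k \<ge> 0" and p1: "p sums 1" and p0: "p 0 > 0" and l: "0 < l" "l < real b" and pb: "p b > 0"
    and mean: "(\<lambda>k. real k * p k) sums \<mu>"
    and dich: "\<mu> = l \<or> \<mu> < l \<and> (\<forall>u>0. \<not> summable (\<lambda>k. p k * exp (real k * u)))"
    and eta: "\<eta> > 0"
  shows "\<exists>K\<ge>b. \<forall>u. 1 - \<eta> \<le> (\<Sum>k\<le>K. p k * exp ((real k - l) * u))"
proof -
  define h where "h = (\<lambda>K u. \<Sum>k\<le>K. p k * exp ((real k - l) * u))"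
  define d where "d = (\<lambda>K. \<Sum>k\<le>K. p k * (real k - l))"
  define P where "P = (\<lambda>K. \<Sum>k\<le>K. p k)"
  have P: "P \<longlonglongrightarrow> 1" using p1 by (simp add: P_def sums_def_le)
  have "(\<lambda>k. real k * p k - l * p k) sums (\<mu> - l * 1)"
    by (intro sums_diff sums_mult mean p1)
  then have d: "d \<longlonglongrightarrow> \<mu> - l" by (simp add: d_def sums_def_le algebra_simps)
  have tangent: "P K + u * d K \<le> h K u" for K u
  proof -
    have "P K + u * d K = (\<Sum>k\<le>K. p k * (1 + (real k - l) * u))"
      by (simp add: P_def d_def sum_distrib_left sum.distrib distrib_left mult_ac)
    also have "\<dots> \<le> h K u"
      unfolding h_def by (intro sum_mono mult_left_mono nn exp_ge_add_one_self)
    finally show ?thesis .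
  qed
  have single: "p k * exp ((real k - l) * u) \<le> h K u" if "k \<le> K" for k K u
    unfolding h_def using that by (intro member_le_sum) (auto simp: nn)
  \<comment> \<open>Threshold beyond which the single term at \<open>b\<close> (for
    \<open>u \<ge> U\<close>) or at \<open>0\<close> (for \<open>u \<le> - U\<close>) is at least
    1.\<close>
  define U where "U = max 0 (max (- ln (p 0) / l) (- ln (p b) / (real b - l)))"
  have U: "U \<ge> 0" "- ln (p 0) \<le> l * U" "- ln (p b) \<le> (real b - l) * U"
  proof -
    have "- ln (p 0) / l \<le> U" "- ln (p b) / (real b - l) \<le> U" by (auto simp: U_def)
    then show "- ln (p 0) \<le> l * U" "- ln (p b) \<le> (real b - l) * U"
      using l by (auto simp: field_simps)
  qed (simp add: U_def)
  have right: "1 \<le> h K u" if "b \<le> K" "U \<le> u" for K u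
  proof -
    have "(real b - l) * U \<le> (real b - l) * u" using that l by simp
    with U have "1 \<le> exp (ln (p b) + (real b - l) * u)" by simp
    also have "\<dots> = p b * exp ((real b - l) * u)" using pb by (simp add: exp_add)
    also have "\<dots> \<le> h K u" using that by (intro single)
    finally show ?thesis .
  qed
  have left: "1 \<le> h K u" if "u \<le> - U" for K u
  proof -
    have "l * U \<le> l * (- u)" using that l by (intro mult_left_mono) auto
    with U have "1 \<le> exp (ln (p 0) + (real 0 - l) * u)" by (simp add: algebra_simps)
    also have "\<dots> = p 0 * exp ((real 0 - l) * u)" using p0 by (simp add: exp_diff exp_minus divide_inverse)
    also have "\<dots> \<le> h K u" by (intro single) simp
    finally show ?thesis .
  qed
  have "\<forall>\<^sub>F K in sequentially. \<forall>u. 1 - \<eta> \<le> h K u"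
    using dich
  proof
    assume "\<mu> = l"
    then have "(\<lambda>K. P K - U * \<bar>d K\<bar>) \<longlonglongrightarrow> 1 - U * \<bar>0\<bar>"
      using d by (intro tendsto_intros P) simp
    then have "\<forall>\<^sub>F K in sequentially. 1 - \<eta> < P K - U * \<bar>d K\<bar>"
      by (rule order_tendstoD) (use eta in simp)
    then show ?thesis using eventually_ge_at_top[of b]
    proof eventually_elim
      case (elim K)
      show ?case
      proof
        fix u
        consider "u \<ge> U" | "u \<le> - U" | "\<bar>u\<bar> \<le> U" by linarith
        then show "1 - \<eta> \<le> h K u"
        proof cases
          case 1 with right[of K u] elim eta show ?thesis by simp
        next
          case 2 with left[of u K] eta show ?thesis by simp
        next
          case 3
          then have "\<bar>u * d K\<bar> \<le> U * \<bar>d K\<bar>" by (simp add: abs_mult mult_right_mono)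
          with tangent[of K u] elim show ?thesis by linarith
        qed
      qed
    qed
  next
    assume *: "\<mu> < l \<and> (\<forall>u>0. \<not> summable (\<lambda>k. p k * exp (real k * u)))"
    \<comment> \<open>On \<open>[0, u0]\<close> each exponent is at least \<open>- l * u0\<close>,
      which by this choice is \<open>- \<eta> / 2\<close>.\<close>
    define u0 where "u0 = \<eta> / (2 * l)"
    have u0: "u0 > 0" using eta l by (simp add: u0_def)
    \<comment> \<open>Only terms that do not decrease with \<open>u\<close> are kept, so divergence
      at the single point \<open>u0\<close> bounds \<open>h K u\<close> for all
      \<open>u \<ge> u0\<close>.\<close>
    define S where "S = (\<lambda>K. \<Sum>k\<le>K. if l \<le> real k then p k * exp ((real k - l) * u0) else 0)"
    have nsum: "\<not> summable (\<lambda>k. if l \<le> real k then p k * exp ((real k - l) * u0) else 0)"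
    proof
      assume "summable (\<lambda>k. if l \<le> real k then p k * exp ((real k - l) * u0) else 0)"
      then have "summable (\<lambda>k. exp (l * u0) * (if l \<le> real k then p k * exp ((real k - l) * u0) else 0))"
        by (rule summable_mult)
      moreover have "\<forall>\<^sub>F k in sequentially.
          exp (l * u0) * (if l \<le> real k then p k * exp ((real k - l) * u0) else 0) = p k * exp (real k * u0)"
        using eventually_ge_at_top[of "nat \<lceil>l\<rceil>"]
        by eventually_elim (auto simp: exp_diff left_diff_distrib ceiling_le_iff)
      ultimately have "summable (\<lambda>k. p k * exp (real k * u0))"
        using summable_cong by force
      with * u0 show False by blast
    qed
    have "\<exists>N. 1 \<le> S N"
    proof (rule ccontr)
      assume "\<nexists>N. 1 \<le> S N"
      then have "S n \<le> 1" for n by (meson linear)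
      then have "summable (\<lambda>k. if l \<le> real k then p k * exp ((real k - l) * u0) else 0)"
        unfolding S_def by (intro bounded_imp_summable[where B = 1]) (auto simp: nn)
      with nsum show False by simp
    qed
    then obtain N where N: "1 \<le> S N" by blast
    have S: "1 \<le> h K u" if "N \<le> K" "u0 \<le> u" for K u
    proof -
      have "1 \<le> S N" by (rule N)
      also have "\<dots> \<le> S K" unfolding S_def using that by (intro sum_mono2) (auto simp: nn)
      also have "\<dots> \<le> h K u"
        unfolding S_def h_def using that by (intro sum_mono) (auto simp: nn intro!: mult_left_mono)
      finally show ?thesis .
    qed
    have "\<forall>\<^sub>F K in sequentially. 1 - \<eta> / 2 < P K"
      using P by (rule order_tendstoD) (use eta in simp)
    moreover have "\<forall>\<^sub>F K in sequentially. d K < 0"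
      using d by (rule order_tendstoD) (use * in simp)
    ultimately show ?thesis using eventually_ge_at_top[of N]
    proof eventually_elim
      case (elim K)
      show ?case
      proof
        fix u
        have P1: "P K \<le> 1" "P K \<ge> 0"
          using sum_le_suminf[of p "{..K}"] p1 nn by (auto simp: P_def sums_iff sum_nonneg)
        consider "u \<ge> u0" | "u \<le> 0" | "0 \<le> u" "u \<le> u0" by linarith
        then show "1 - \<eta> \<le> h K u"
        proof cases
          case 1 with S[of K u] elim eta show ?thesis by simp
        next
          case 2
          then have "u * d K \<ge> 0" using elim by (simp add: mult_nonpos_nonpos)
          with tangent[of K u] elim eta show ?thesis by linarith
        next
          case 3
          have "1 - \<eta> \<le> P K + - (l * u0)" using elim l eta by (simp add: u0_def)
          also have "\<dots> \<le> P K + P K * (- (l * u0))"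
          proof -
            have "P K * (l * u0) \<le> 1 * (l * u0)" using P1 l u0 by (intro mult_right_mono) auto
            then show ?thesis by simp
          qed
          also have "\<dots> = P K * (1 + (- (l * u0)))" by (simp add: algebra_simps)
          also have "\<dots> \<le> P K * exp (- (l * u0))"
            using P1 by (intro mult_left_mono exp_ge_add_one_self)
          also have "\<dots> \<le> h K u"
            unfolding P_def h_def sum_distrib_right
          proof (intro sum_mono mult_left_mono nn)
            fix k
            have "l * u \<le> l * u0" "0 \<le> real k * u" using 3 l by auto
            then have "- (l * u0) \<le> (real k - l) * u"
              by (simp add: left_diff_distrib)
            then show "exp (- (l * u0)) \<le> exp ((real k - l) * u)" by simp
          qed
          finally show ?thesis .
        qed
      qed
    qed
  qed
  then have "\<forall>\<^sub>F K in sequentially. (\<forall>u. 1 - \<eta> \<le> h K u) \<and> b \<le> K"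
    using eventually_ge_at_top[of b] by eventually_elim auto
  then show ?thesis unfolding h_def by (auto simp: eventually_sequentially)
qed

text \<open>The sum is the derivative in \<open>x\<close> of the truncated, centred moment
  generating function. It is nonpositive far to the left and nonnegative far to the right; a zero is
  a tilt under which the truncated weights have mean \<open>l\<close>.\<close>

lemma exists_tilt_with_mean:
  fixes p :: "nat \<Rightarrow> real"
  assumes nn: "\<And>k. p k \<ge> 0" and p0: "p 0 > 0" and l: "0 < l" "l < real b" and pb: "p b > 0" and "b \<le> K"
  shows "\<exists>x. (\<Sum>k\<le>K. p k * exp ((real k - l) * x) * (real k - l)) = 0"
proof -
  define g where "g = (\<lambda>x. \<Sum>k\<le>K. p k * exp ((real k - l) * x) * (real k - l))"
  define S where "S = (\<Sum>k\<le>K. p k * \<bar>real k - l\<bar>)"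
  have S: "S \<ge> 0" unfolding S_def by (intro sum_nonneg) (simp add: nn)
  \<comment> \<open>Since \<open>exp y \<ge> y\<close>, the term at \<open>b\<close> has size at
    least \<open>S\<close> at \<open>X\<close>, and so has the term at \<open>0\<close> at
    \<open>- X\<close>; \<open>S\<close> bounds the terms of opposite sign.\<close>
  define X where "X = S / (p 0 * l * l) + S / (p b * (real b - l) * (real b - l))"
  have "X \<ge> S / (p 0 * l * l)" "X \<ge> S / (p b * (real b - l) * (real b - l))"
    using S l p0 pb by (auto simp: X_def)
  then have X1: "S \<le> p 0 * l * (l * X)" "S \<le> p b * (real b - l) * ((real b - l) * X)"
    using l p0 pb by (auto simp: pos_divide_le_eq mult_ac)
  have X: "X \<ge> 0" unfolding X_def using S l p0 pb by simp
  have term_ge: "- (p k * \<bar>real k - l\<bar>) \<le> p k * exp ((real k - l) * X) * (real k - l)" for k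
  proof (cases "real k \<ge> l")
    case True
    then have "0 \<le> p k * exp ((real k - l) * X) * (real k - l)" by (simp add: nn)
    moreover have "0 \<le> p k * \<bar>real k - l\<bar>" by (simp add: nn)
    ultimately show ?thesis by linarith
  next
    case False
    then have "exp ((real k - l) * X) \<le> 1" using X by (simp add: mult_nonpos_nonneg)
    then have "p k * exp ((real k - l) * X) * (l - real k) \<le> p k * 1 * (l - real k)"
      using False nn by (intro mult_right_mono mult_left_mono) auto
    then show ?thesis using False by (simp add: algebra_simps)
  qed
  have term_le: "p k * exp ((real k - l) * - X) * (real k - l) \<le> p k * \<bar>real k - l\<bar>" for k
  proof (cases "real k \<ge> l")
    case False
    then have "p k * exp ((real k - l) * - X) * (real k - l) \<le> 0"
      by (simp add: nn mult_nonneg_nonpos)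
    moreover have "0 \<le> p k * \<bar>real k - l\<bar>" by (simp add: nn)
    ultimately show ?thesis by linarith
  next
    case True
    then have "exp ((real k - l) * - X) \<le> 1" using X by simp
    then have "p k * exp ((real k - l) * - X) * (real k - l) \<le> p k * 1 * (real k - l)"
      using True nn by (intro mult_right_mono mult_left_mono) auto
    then show ?thesis using True by simp
  qed
  have "0 \<le> g X"
  proof -
    have "S \<le> p b * (real b - l) * exp ((real b - l) * X)"
      using X1(2) exp_ge_add_one_self[of "(real b - l) * X"] l pb
      by (smt (verit) mult_le_cancel_left_pos mult_pos_pos)
    moreover have "p b * exp ((real b - l) * X) * (real b - l) - S
      \<le> p b * exp ((real b - l) * X) * (real b - l) - (\<Sum>k\<in>{..K} - {b}. p k * \<bar>real k - l\<bar>)"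
      unfolding S_def by (intro diff_left_mono sum_mono2) (auto simp: nn)
    moreover have "\<dots> \<le> g X"
    proof -
      have "- (\<Sum>k\<in>{..K} - {b}. p k * \<bar>real k - l\<bar>) \<le> (\<Sum>k\<in>{..K} - {b}. p k * exp ((real k - l) * X) * (real k - l))"
        unfolding sum_negf[symmetric] by (intro sum_mono term_ge)
      then show ?thesis unfolding g_def using \<open>b \<le> K\<close> by (subst sum.remove[of _ b]) auto
    qed
    ultimately show ?thesis by (simp add: mult_ac)
  qed
  moreover have "g (- X) \<le> 0"
  proof -
    have "S \<le> p 0 * l * exp (l * X)"
      using X1(1) exp_ge_add_one_self[of "l * X"] l p0
      by (smt (verit) mult_le_cancel_left_pos mult_pos_pos)
    moreover have "(\<Sum>k\<in>{..K} - {0}. p k * \<bar>real k - l\<bar>) - p 0 * l * exp (l * X)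
      \<le> S - p 0 * l * exp (l * X)"
      unfolding S_def by (intro diff_right_mono sum_mono2) (auto simp: nn)
    moreover have "g (- X) \<le> (\<Sum>k\<in>{..K} - {0}. p k * \<bar>real k - l\<bar>) - p 0 * l * exp (l * X)"
    proof -
      have "(\<Sum>k\<in>{..K} - {0}. p k * exp ((real k - l) * - X) * (real k - l)) \<le> (\<Sum>k\<in>{..K} - {0}. p k * \<bar>real k - l\<bar>)"
        by (intro sum_mono term_le)
      then show ?thesis unfolding g_def by (subst sum.remove[of _ 0]) (auto simp: mult_ac)
    qed
    ultimately show ?thesis by linarith
  qed
  moreover have "continuous_on {- X..X} g"
    unfolding g_def by (intro continuous_intros)
  ultimately have "\<exists>x\<ge>- X. x \<le> X \<and> g x = 0" using X by (intro IVT') auto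
  then show ?thesis unfolding g_def by auto
qed

text \<open>Change of measure: the weak law applies to the truncated weights tilted to mean
  \<open>l\<close>. Returning to \<open>p\<close> costs a polynomial factor, the normalising
  constant \<open>G ^ n\<close> and the tilt \<open>exp (x * (m - l * n))\<close>; each is given a
  third of the exponent \<open>\<eta>\<close>.\<close>

lemma Zmn_bulk:
  fixes p :: "nat \<Rightarrow> real"
  assumes nn: "\<And>k. p k \<ge> 0" and p0: "p 0 > 0" and l: "0 < l" "l < real b" and pb: "p b > 0"
    and moment: "\<And>\<eta>. \<eta> > 0 \<Longrightarrow> \<exists>K\<ge>b. \<forall>u. 1 - \<eta> \<le> (\<Sum>k\<le>K. p k * exp ((real k - l) * u))"
    and eta: "\<eta> > 0" and \<delta>: "\<delta> > 0"
  shows "\<forall>\<^sub>F n in sequentially. \<exists>m. \<bar>real m - l * real n\<bar> \<le> \<delta> * real n \<and> exp (- \<eta> * real n) \<le> Zmn p m n"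
proof -
  have "1 - exp (- \<eta> / 3) > 0" using eta by simp
  from moment[OF this] obtain K where K: "b \<le> K"
    "\<And>u. exp (- \<eta> / 3) \<le> (\<Sum>k\<le>K. p k * exp ((real k - l) * u))" by auto
  from exists_tilt_with_mean[OF nn p0 l pb K(1)] obtain x
    where x: "(\<Sum>k\<le>K. p k * exp ((real k - l) * x) * (real k - l)) = 0" by blast
  define G where "G = (\<Sum>k\<le>K. p k * exp ((real k - l) * x))"
  have G: "exp (- \<eta> / 3) \<le> G" unfolding G_def by (rule K)
  have Gpos: "G > 0" using G exp_gt_zero[of "- \<eta> / 3"] by linarith
  define t where "t = (\<lambda>k. if k \<le> K then p k else 0)"
  define q where "q = (\<lambda>k. (exp (- l * x) / G) * t k * exp x ^ k)"
  have q_eq: "q k = p k * exp ((real k - l) * x) / G" if "k \<le> K" for k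
    using that by (simp add: q_def t_def exp_of_nat_mult[symmetric] left_diff_distrib exp_diff exp_minus field_simps)
  have q_nn: "q k \<ge> 0" for k using Gpos nn by (simp add: q_def t_def)
  have q_fin: "q k = 0" if "k > K" for k using that by (simp add: q_def t_def)
  have q_tot: "(\<Sum>k\<le>K. q k) = 1"
    using Gpos by (simp add: q_eq sum_divide_distrib[symmetric] G_def[symmetric])
  have q_mean: "(\<Sum>k\<le>K. q k * (real k - l)) = 0"
  proof -
    have "(\<Sum>k\<le>K. q k * (real k - l)) = (\<Sum>k\<le>K. p k * exp ((real k - l) * x) * (real k - l)) / G"
      by (simp add: q_eq sum_divide_distrib)
    then show ?thesis by (simp add: x)
  qed
  \<comment> \<open>Limits the tilt cost to \<open>exp (\<eta> / 3 * n)\<close>; the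
    \<open>+ 1\<close> avoids division by zero when \<open>x = 0\<close>.\<close>
  define \<delta>' where "\<delta>' = min \<delta> (\<eta> / (3 * (\<bar>x\<bar> + 1)))"
  have \<delta>': "\<delta>' > 0" "\<delta>' \<le> \<delta>" using eta \<delta> by (auto simp: \<delta>'_def)
  have x\<delta>': "\<bar>x\<bar> * \<delta>' \<le> \<eta> / 3"
  proof -
    have "\<bar>x\<bar> * \<delta>' \<le> (\<bar>x\<bar> + 1) * (\<eta> / (3 * (\<bar>x\<bar> + 1)))"
      using \<delta>' by (intro mult_mono) (auto simp: \<delta>'_def)
    also have "\<dots> = \<eta> / 3" by (simp add: field_simps add_nonneg_eq_0_iff)
    finally show ?thesis .
  qed
  have "(\<lambda>n. 2 * (real K * real n + 1) * exp (- (\<eta> / 3) * real n)) \<longlonglongrightarrow> 0"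
    using eta by real_asymp
  then have "\<forall>\<^sub>F n in sequentially. 2 * (real K * real n + 1) * exp (- (\<eta> / 3) * real n) < 1"
    by (rule order_tendstoD) simp
  moreover have "\<forall>\<^sub>F n in sequentially. \<exists>m. \<bar>real m - l * real n\<bar> \<le> \<delta>' * real n
      \<and> 1 / (2 * (real (K * n) + 1)) \<le> Zmn q m n"
    by (rule Zmn_concentration[OF q_nn q_fin q_tot q_mean \<delta>'(1)])
  ultimately show ?thesis
  proof eventually_elim
    case (elim n)
    from elim(2) obtain m where m: "\<bar>real m - l * real n\<bar> \<le> \<delta>' * real n"
      "1 / (2 * (real (K * n) + 1)) \<le> Zmn q m n" by blast
    have "exp (- (\<eta> / 3) * real n) \<le> 1 / (2 * (real (K * n) + 1))"
    proof -
      have "2 * (real (K * n) + 1) > 0" using of_nat_0_le_iff[of "K * n", where 'a = real] by (simp add: add_nonneg_pos)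
      then show ?thesis using elim(1) by (simp add: field_simps)
    qed
    also note m(2)
    also have "Zmn q m n = (exp (- l * x) / G) ^ n * exp x ^ m * Zmn t m n"
      unfolding q_def by (rule Zmn_tilt)
    also have "\<dots> = exp (x * (real m - l * real n)) / G ^ n * Zmn t m n"
      by (simp add: power_divide exp_of_nat_mult[symmetric] right_diff_distrib exp_diff exp_minus field_simps exp_add[symmetric])
    finally have "exp (- (\<eta> / 3) * real n) \<le> exp (x * (real m - l * real n)) / G ^ n * Zmn t m n" .
    then have "exp (- (\<eta> / 3) * real n) * G ^ n * exp (- (x * (real m - l * real n))) \<le> Zmn t m n"
      using Gpos unfolding exp_minus[of "x * (real m - l * real n)"]
      by (simp add: pos_le_divide_eq pos_divide_le_eq divide_inverse[symmetric] mult_ac del: exp_minus)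
    moreover have "exp (- (\<eta> / 3) * real n) * exp (- (\<eta> / 3) * real n) * exp (- (\<eta> / 3) * real n)
      \<le> exp (- (\<eta> / 3) * real n) * G ^ n * exp (- (x * (real m - l * real n)))"
    proof (intro mult_mono)
      show "exp (- (\<eta> / 3) * real n) \<le> G ^ n"
        using power_mono[OF G, of n] by (simp add: exp_of_nat2_mult[symmetric] mult_ac)
      have "x * (real m - l * real n) \<le> \<bar>x\<bar> * \<bar>real m - l * real n\<bar>"
        by (metis abs_ge_self abs_mult)
      also have "\<dots> \<le> \<bar>x\<bar> * (\<delta>' * real n)" using m(1) by (intro mult_left_mono) auto
      also have "\<dots> \<le> \<eta> / 3 * real n"
        using mult_right_mono[OF x\<delta>', of "real n"] by (simp add: mult_ac)
      finally show "exp (- (\<eta> / 3) * real n) \<le> exp (- (x * (real m - l * real n)))" by simp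
    qed (use Gpos in auto)
    moreover have "exp (- (\<eta> / 3) * real n) * exp (- (\<eta> / 3) * real n) * exp (- (\<eta> / 3) * real n) = exp (- \<eta> * real n)"
      by (simp add: exp_add[symmetric])
    moreover have "Zmn t m n \<le> Zmn p m n"
      by (rule Zmn_mono) (auto simp: t_def nn)
    moreover have "\<bar>real m - l * real n\<bar> \<le> \<delta> * real n"
      using m(1) mult_right_mono[OF \<delta>'(2), of "real n"] by simp
    ultimately show ?case by (intro exI[of _ m] conjI) linarith+
  qed
qed

text \<open>Every large number congruent modulo \<open>b\<close> to an attainable one is attainable, by adding boxes with \<open>b\<close> balls
  to a fixed representative of its residue class; this handles the lattice condition without mentioning the span.\<close>

lemma Zmn_fill:
  fixes p :: "nat \<Rightarrow> real"
  assumes nn: "\<And>k. p k \<ge> 0" and p0: "p 0 > 0" and pb: "p b > 0" and b: "b > 0"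
  shows "\<exists>C \<kappa>. 0 < \<kappa> \<and> \<kappa> \<le> 1 \<and> (\<forall>s n0 x r. Zmn p s n0 > 0 \<longrightarrow> x mod b = s mod b \<longrightarrow> C \<le> x \<longrightarrow>
            C + x div b \<le> r \<longrightarrow> \<kappa> ^ Suc r \<le> Zmn p x r)"
proof -
  \<comment> \<open>One residue class \<open>i\<close> at a time; a class without attainable numbers
    makes the claim vacuous. As there are only \<open>b\<close> classes, a common maximum and
    minimum can be taken afterwards.\<close>
  have "\<exists>C \<kappa>. 0 < \<kappa> \<and> \<kappa> \<le> 1 \<and> (\<forall>s n0 x r. Zmn p s n0 > 0 \<longrightarrow> x mod b = s mod b \<longrightarrow> s mod b = i \<longrightarrow> C \<le> x \<longrightarrow>
            C + x div b \<le> r \<longrightarrow> \<kappa> ^ Suc r \<le> Zmn p x r)" for i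
  proof (cases "\<exists>s n0. Zmn p s n0 > 0 \<and> s mod b = i")
    case False
    then show ?thesis by (intro exI[of _ 0] exI[of _ 1]) auto
  next
    case True
    then obtain c q where c: "Zmn p c q > 0" "c mod b = i" by blast
    define \<kappa> where "\<kappa> = min 1 (min (Zmn p c q) (min (p 0) (p b)))"
    have \<kappa>: "0 < \<kappa>" "\<kappa> \<le> 1" "\<kappa> \<le> Zmn p c q" "\<kappa> \<le> p 0" "\<kappa> \<le> p b" using c p0 pb by (auto simp: \<kappa>_def)
    have "\<kappa> ^ Suc r \<le> Zmn p x r" if x: "x mod b = i" "c + q \<le> x" "c + q + x div b \<le> r" for x r
    proof -
      obtain j where j: "x = c + j * b"
        using x c by (metis add_leD1 le_add_diff_inverse mod_eq_dvd_iff_nat dvd_def mult.commute)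
      have "j \<le> x div b" using b j by (metis div_le_mono le_add2 nonzero_mult_div_cancel_right not_gr_zero)
      with x have le: "q + j \<le> r" by linarith
      \<comment> \<open>One factor pays for the representative \<open>c\<close> in \<open>q\<close>
        boxes, \<open>j\<close> factors for the boxes with \<open>b\<close> balls, the others for
        empty boxes.\<close>
      have "\<kappa> ^ Suc r \<le> \<kappa> ^ (Suc (j + (r - q - j)))"
        using \<kappa> le by (intro power_decreasing) auto
      also have "\<dots> = \<kappa> * (\<kappa> ^ j * \<kappa> ^ (r - q - j))" by (simp add: power_add)
      also have "\<dots> \<le> Zmn p c q * (p b ^ j * p 0 ^ (r - q - j))"
        using \<kappa> c by (intro mult_mono power_mono) auto
      also have "\<dots> \<le> Zmn p c q * (Zmn p (j * b) j * Zmn p ((r - q - j) * 0) (r - q - j))"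
        using c nn by (intro mult_left_mono mult_mono Zmn_replicate) (auto simp: Zmn_nonneg)
      also have "\<dots> \<le> Zmn p c q * Zmn p (j * b + (r - q - j) * 0) (j + (r - q - j))"
        using c nn by (intro mult_left_mono Zmn_superadditive) auto
      also have "\<dots> \<le> Zmn p (c + (j * b + (r - q - j) * 0)) (q + (j + (r - q - j)))"
        by (intro Zmn_superadditive nn)
      finally show ?thesis using le j by simp
    qed
    then show ?thesis using \<kappa>(1,2) by (intro exI[of _ "c + q"] exI[of _ \<kappa>]) auto
  qed
  then obtain C \<kappa> where C\<kappa>: "\<And>i. 0 < \<kappa> i" "\<And>i. \<kappa> i \<le> 1"
    "\<And>i s n0 x r. Zmn p s n0 > 0 \<Longrightarrow> x mod b = s mod b \<Longrightarrow> s mod b = i \<Longrightarrow> C i \<le> x \<Longrightarrow>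
            C i + x div b \<le> r \<Longrightarrow> \<kappa> i ^ Suc r \<le> Zmn p x r" by metis
  define \<kappa>' where "\<kappa>' = Min (\<kappa> ` {..<b})"
  define C' where "C' = Max (C ` {..<b})"
  have ne: "{..<b} \<noteq> {}" using b by auto
  have 1: "0 < \<kappa>'" "\<kappa>' \<le> 1"
    using C\<kappa>(1,2) b ne by (auto simp: \<kappa>'_def Min_le_iff)
  have 2: "\<kappa>' \<le> \<kappa> i" "C i \<le> C'" if "i < b" for i
    using that by (auto simp: \<kappa>'_def C'_def)
  have "\<kappa>' ^ Suc r \<le> Zmn p x r" if "Zmn p s n0 > 0" "x mod b = s mod b" "C' \<le> x" "C' + x div b \<le> r" for s n0 x r
  proof -
    have i: "s mod b < b" using b by simp
    have "\<kappa>' ^ Suc r \<le> \<kappa> (s mod b) ^ Suc r" using 1 2[OF i] by (intro power_mono) auto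
    also have "\<dots> \<le> Zmn p x r" using that 2[OF i] by (intro C\<kappa>(3)[of s n0]) auto
    finally show ?thesis .
  qed
  then show ?thesis using 1 by (intro exI[of _ C'] exI[of _ \<kappa>']) auto
qed

text \<open>Most balls go into \<open>n1\<close> boxes by the bulk estimate, and the remaining
  \<open>x\<close> balls, roughly \<open>l * n2\<close>, into the few other boxes. Since
  \<open>0 < l < b\<close>, this number lies well inside the range that \<open>Zmn_fill\<close> can
  absorb, at a cost exponential only in \<open>n2\<close>.\<close>

lemma Zmn_subexponential_lower_bound:
  fixes p :: "nat \<Rightarrow> real"
  assumes nn: "\<And>k. p k \<ge> 0" and p0: "p 0 > 0" and l: "0 < l" "l < real b" and pb: "p b > 0"
    and moment: "\<And>\<eta>. \<eta> > 0 \<Longrightarrow> \<exists>K\<ge>b. \<forall>u. 1 - \<eta> \<le> (\<Sum>k\<le>K. p k * exp ((real k - l) * u))"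
    and m_lim: "(\<lambda>n. real (m n) / real n) \<longlonglongrightarrow> l" and eta: "\<eta> > 0"
  shows "\<forall>\<^sub>F n in sequentially. Zmn p (m n) n > 0 \<longrightarrow> exp (- \<eta> * real n) \<le> Zmn p (m n) n"
proof -
  have b: "b > 0" using l by (cases b) auto
  define \<epsilon> where "\<epsilon> = \<eta> / 3"
  have eps: "\<epsilon> > 0" using eta by (simp add: \<epsilon>_def)
  from Zmn_fill[OF nn p0 pb b] obtain C \<kappa> where \<kappa>: "0 < \<kappa>" "\<kappa> \<le> 1"
    and fill: "\<And>s n0 x r. Zmn p s n0 > 0 \<Longrightarrow> x mod b = s mod b \<Longrightarrow> C \<le> x \<Longrightarrow>
            C + x div b \<le> r \<Longrightarrow> \<kappa> ^ Suc r \<le> Zmn p x r" by blast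
  \<comment> \<open>With at most \<open>n / D\<close> boxes at cost \<open>\<kappa>\<close> each,
    the loss is at most \<open>exp (\<epsilon> * n)\<close>; \<open>D \<ge> 2\<close> keeps at least
    half of the boxes in the bulk, so \<open>n1\<close> tends to infinity.\<close>
  define D where "D = max 2 (nat \<lceil>- ln \<kappa> / \<epsilon>\<rceil>)"
  have D: "D \<ge> 2" by (simp add: D_def)
  have "- ln \<kappa> / \<epsilon> \<le> real D" unfolding D_def by linarith
  then have D\<kappa>: "- ln \<kappa> \<le> \<epsilon> * real D" using eps by (simp add: field_simps)
  \<comment> \<open>The error \<open>2 * \<delta> * n\<close> in the number of remaining balls then
    uses at most half of the margins \<open>l * n / D\<close> and
    \<open>(b - l) * n / D\<close>.\<close>
  define \<delta> where "\<delta> = min l (real b - l) / (4 * real D)"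
  have \<delta>: "\<delta> > 0" using l D by (simp add: \<delta>_def)
  have \<delta>1: "2 * \<delta> \<le> l / (2 * real D)" and \<delta>2: "2 * \<delta> \<le> (real b - l) / (2 * real D)"
    using D by (auto simp: \<delta>_def field_simps min_def)
  have lim: "filterlim (\<lambda>n. n - n div D) at_top sequentially"
  proof (rule filterlim_at_top_mono)
    show "filterlim (\<lambda>n::nat. n div 2) at_top sequentially"
      by (rule filterlim_at_top_div_const_nat) simp
    have "n div 2 \<le> n - n div D" for n
      using div_le_mono2[of 2 D n] D by linarith
    then show "\<forall>\<^sub>F n in sequentially. n div 2 \<le> n - n div D" by simp
  qed
  have bulk: "\<forall>\<^sub>F n in sequentially. \<exists>m'. \<bar>real m' - l * real (n - n div D)\<bar> \<le> \<delta> * real (n - n div D)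
      \<and> exp (- \<epsilon> * real (n - n div D)) \<le> Zmn p m' (n - n div D)"
    by (rule eventually_compose_filterlim[OF Zmn_bulk[OF nn p0 l pb moment eps \<delta>] lim])
  have ev1: "\<forall>\<^sub>F n in sequentially. \<bar>real (m n) / real n - l\<bar> < \<delta>"
    using m_lim \<delta> unfolding tendsto_iff dist_real_def by blast
  have "filterlim (\<lambda>n. c * real n) at_top sequentially" if "c > 0" for c :: real
    using that by real_asymp
  then have big: "\<forall>\<^sub>F n in sequentially. a \<le> c * real n" if "c > 0" for a c :: real
    using that by (simp add: filterlim_at_top)
  have c1: "l / (2 * real D) > 0" and c2: "(real b - l) / (2 * real D) > 0" using l D by auto
  show ?thesis
    using bulk ev1 big[OF c1, of "real C + l"] big[OF c2, of "real b * real C + real b"] big[OF eps, of "- ln \<kappa>"]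
      eventually_gt_at_top[of 0]
  proof eventually_elim
    case (elim n)
    define n2 where "n2 = n div D"
    define n1 where "n1 = n - n2"
    have n12: "n = n1 + n2" by (simp add: n1_def n2_def)
    from elim(1) obtain m' where m': "\<bar>real m' - l * real n1\<bar> \<le> \<delta> * real n1"
      "exp (- \<epsilon> * real n1) \<le> Zmn p m' n1" unfolding n1_def n2_def by blast
    have n2_le: "real n2 * real D \<le> real n"
      unfolding n2_def by (metis of_nat_le_iff of_nat_mult div_times_less_eq_dividend)
    have n2_ge: "real n / real D - 1 \<le> real n2"
      unfolding n2_def using floor_divide_of_nat_eq[of n D, where 'a = real] by linarith
    have mn: "\<bar>real (m n) - l * real n\<bar> \<le> \<delta> * real n"
    proof -
      have "real (m n) - l * real n = (real (m n) / real n - l) * real n" using elim(6) by (simp add: field_simps)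
      then have "\<bar>real (m n) - l * real n\<bar> = \<bar>real (m n) / real n - l\<bar> * real n" by (simp add: abs_mult)
      then show ?thesis using elim(2) by (simp add: mult_right_mono)
    qed
    have "\<delta> * real n1 \<le> \<delta> * real n" using \<delta> n12 by simp
    with m' mn have diff: "\<bar>(real (m n) - real m') - l * real n2\<bar> \<le> 2 * \<delta> * real n"
      by (simp add: n12 distrib_left)
    have x_ge: "real m' + real C \<le> real (m n)"
    proof -
      have "l * (real n / real D - 1) \<le> l * real n2" using l n2_ge by (intro mult_left_mono) auto
      moreover have "2 * \<delta> * real n \<le> l / (2 * real D) * real n" using \<delta>1 by (intro mult_right_mono) auto
      moreover have "l * (real n / real D - 1) - l / (2 * real D) * real n = l / (2 * real D) * real n - l"
        using D by (simp add: field_simps)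
      ultimately show ?thesis using diff elim(3) by linarith
    qed
    define x where "x = m n - m'"
    have x: "m n = m' + x" "C \<le> x" using x_ge unfolding x_def by linarith+
    have "C + x div b \<le> n2"
    proof -
      have "(real b - l) * (real n / real D - 1) \<le> (real b - l) * real n2"
        using l n2_ge by (intro mult_left_mono) auto
      moreover have "2 * \<delta> * real n \<le> (real b - l) / (2 * real D) * real n" using \<delta>2 by (intro mult_right_mono) auto
      moreover have "(real b - l) * (real n / real D - 1) - (real b - l) / (2 * real D) * real n
          = (real b - l) / (2 * real D) * real n - (real b - l)"
        using D by (simp add: field_simps)
      moreover have "real x \<le> l * real n2 + 2 * \<delta> * real n" using diff x(1) by simp
      moreover have "(real b - l) * real n2 = real b * real n2 - l * real n2" by (rule left_diff_distrib)
      ultimately have "real b * real C + real x \<le> real b * real n2"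
        using elim(4) l by linarith
      then have "b * C + x \<le> b * n2"
        by (metis of_nat_add of_nat_le_iff of_nat_mult)
      then have "(b * C + x) div b \<le> (b * n2) div b" by (rule div_le_mono)
      then show ?thesis using b by simp
    qed
    show ?case
    proof
      assume pos: "Zmn p (m n) n > 0"
      have pos': "Zmn p m' n1 > 0" using m'(2) exp_gt_zero[of "- \<epsilon> * real n1"] by linarith
      \<comment> \<open>An attainable number congruent to \<open>x = m n - m'\<close> modulo
        \<open>b\<close> is needed. Subtracting \<open>m'\<close> is replaced by adding it
        \<open>b - 1\<close> times, which gives the same residue and is attainable by
        concatenation.\<close>
      have pos_rep: "Zmn p (j * m') (j * n1) > 0" for j
      proof (induction j)
        case 0
        then show ?case by (simp add: Zmn_0)
      next
        case (Suc j)
        with pos' have "0 < Zmn p m' n1 * Zmn p (j * m') (j * n1)" by simp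
        also have "\<dots> \<le> Zmn p (m' + j * m') (n1 + j * n1)" by (rule Zmn_superadditive[OF nn])
        finally show ?case by simp
      qed
      have "0 < Zmn p (m n) n * Zmn p ((b - 1) * m') ((b - 1) * n1)" using pos pos_rep by simp
      also have "\<dots> \<le> Zmn p (m n + (b - 1) * m') (n + (b - 1) * n1)" by (rule Zmn_superadditive[OF nn])
      finally have s: "0 < Zmn p (m n + (b - 1) * m') (n + (b - 1) * n1)" .
      have "m n + (b - 1) * m' = x + b * m'"
        using x(1) b by (cases b) auto
      then have "x mod b = (m n + (b - 1) * m') mod b" by simp
      from fill[OF s this x(2) \<open>C + x div b \<le> n2\<close>] have Zx: "\<kappa> ^ Suc n2 \<le> Zmn p x n2" .
      have "exp (- \<epsilon> * real n) \<le> \<kappa> ^ n2"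
      proof -
        have "real n2 * (- ln \<kappa>) \<le> real n2 * (\<epsilon> * real D)" using D\<kappa> by (intro mult_left_mono) auto
        also have "\<dots> = \<epsilon> * (real n2 * real D)" by simp
        also have "\<dots> \<le> \<epsilon> * real n" using n2_le eps by (intro mult_left_mono) auto
        finally have "- \<epsilon> * real n \<le> real n2 * ln \<kappa>" by simp
        then have "exp (- \<epsilon> * real n) \<le> exp (real n2 * ln \<kappa>)" by simp
        also have "\<dots> = \<kappa> ^ n2" using \<kappa> by (simp add: exp_of_nat_mult)
        finally show ?thesis .
      qed
      \<comment> \<open>Pays for the extra factor in \<open>\<kappa> ^ Suc n2\<close>.\<close>
      moreover have "exp (- \<epsilon> * real n) \<le> \<kappa>"
      proof -
        have "exp (- \<epsilon> * real n) \<le> exp (ln \<kappa>)" using elim(5) unfolding exp_le_cancel_iff by linarith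
        then show ?thesis using \<kappa> by simp
      qed
      ultimately have "exp (- \<epsilon> * real n) * exp (- \<epsilon> * real n) \<le> \<kappa> * \<kappa> ^ n2"
        using \<kappa> by (intro mult_mono) auto
      with Zx have Zx': "exp (- \<epsilon> * real n) * exp (- \<epsilon> * real n) \<le> Zmn p x n2" by simp
      have "\<epsilon> * real n1 \<le> \<epsilon> * real n" using n12 eps by simp
      then have "exp (- \<epsilon> * real n) \<le> exp (- \<epsilon> * real n1)" by simp
      with m'(2) have "exp (- \<epsilon> * real n) \<le> Zmn p m' n1" by linarith
      with Zx' have "exp (- \<epsilon> * real n) * (exp (- \<epsilon> * real n) * exp (- \<epsilon> * real n)) \<le> Zmn p m' n1 * Zmn p x n2"
        using pos' by (intro mult_mono) auto
      also have "\<dots> \<le> Zmn p (m' + x) (n1 + n2)" by (rule Zmn_superadditive[OF nn])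
      finally show "exp (- \<eta> * real n) \<le> Zmn p (m n) n"
        using x(1) n12 by (simp add: \<epsilon>_def exp_add[symmetric])
    qed
  qed
qed

section \<open>Concentration of the occupation numbers\<close>

text \<open>Chernoff's bound with the moment generating function of a Bernoulli variable of
  parameter \<open>p k\<close>. Conditioning on the number of balls costs the factor
  \<open>1 / Zmn p (m n) n\<close>, which is subexponential by \<open>lower\<close>. The values 1
  and -1 of \<open>\<sigma>\<close> give the two tails.\<close>

lemma Ncount_tail:
  fixes p :: "nat \<Rightarrow> real"
  assumes nn: "\<And>k. p k \<ge> 0" and p1: "p sums 1"
    and lower: "\<And>\<eta>. \<eta> > 0 \<Longrightarrow> \<forall>\<^sub>F n in sequentially. Zmn p (m n) n > 0 \<longrightarrow> exp (- \<eta> * real n) \<le> Zmn p (m n) n"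
    and "\<epsilon> > 0" "\<delta> > 0"
  shows "\<forall>\<^sub>F n in sequentially. Zmn p (m n) n > 0 \<longrightarrow>
     prob_BB p (m n) n (\<lambda>y. \<sigma> * (real (Ncount n k y) - p k * real n) > \<epsilon> * real n) < \<delta>"
proof -
  have p_le: "p k \<le> 1" using sum_le_suminf[of p "{k}"] p1 nn by (auto simp: sums_iff)
  \<comment> \<open>Law \<open>q\<close> of a Bernoulli variable indexed by \<open>bool\<close>, and
    its centred values \<open>c\<close> shifted to have mean \<open>- \<epsilon>\<close>.\<close>
  define q where "q = (\<lambda>t. if t then p k else 1 - p k)"
  define c where "c = (\<lambda>t. \<sigma> * ((if t then 1 else 0) - p k) - \<epsilon>)"
  have "(\<Sum>t\<in>UNIV. q t) = 1" by (simp add: UNIV_bool q_def)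
  moreover have "(\<Sum>t\<in>UNIV. q t * c t) = - \<epsilon>" by (simp add: UNIV_bool q_def c_def algebra_simps)
  ultimately obtain s where s: "s > 0" "(\<Sum>t\<in>UNIV. q t * exp (s * c t)) < 1"
    using sum_exp_less_1[of UNIV q c] \<open>\<epsilon> > 0\<close> by auto
  define R where "R = (\<Sum>t\<in>UNIV. q t * exp (s * c t))"
  define E where "E = 1 + p k * (exp (s * \<sigma>) - 1)"
  have R_eq: "R = E * exp (- (s * (\<sigma> * p k + \<epsilon>)))"
  proof -
    have e: "exp (s * c True) = exp (s * \<sigma>) * exp (- (s * (\<sigma> * p k + \<epsilon>)))"
      "exp (s * c False) = exp (- (s * (\<sigma> * p k + \<epsilon>)))"
      unfolding exp_add[symmetric] c_def by (auto simp: algebra_simps)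
    have "R = p k * exp (s * c True) + (1 - p k) * exp (s * c False)"
      by (simp add: R_def UNIV_bool q_def)
    then show ?thesis unfolding e E_def by (simp add: algebra_simps)
  qed
  have R: "0 < R" "R < 1"
  proof -
    have "R \<ge> 0" unfolding R_def using nn p_le by (intro sum_nonneg) (auto simp: q_def)
    moreover have "R \<noteq> 0"
      using nn[of k] p_le
      by (auto simp: R_def UNIV_bool q_def add_nonneg_eq_0_iff)
    ultimately show "0 < R" by simp
  qed (use s in \<open>simp add: R_def\<close>)
  \<comment> \<open>Half of the exponential rate is spent on the lower bound for \<open>Zmn\<close>;
    the other half remains as decay.\<close>
  define \<eta> where "\<eta> = - ln R / 2"
  have eta: "\<eta> > 0" using R by (simp add: \<eta>_def)
  have "(\<lambda>n. exp (- \<eta> * real n)) \<longlonglongrightarrow> 0" using eta by real_asymp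
  then have "\<forall>\<^sub>F n in sequentially. exp (- \<eta> * real n) < \<delta>"
    by (rule order_tendstoD) (rule \<open>\<delta> > 0\<close>)
  with lower[OF eta] show ?thesis
  proof eventually_elim
    case (elim n)
    show ?case
    proof
      assume pos: "Zmn p (m n) n > 0"
      define v where "v = p(k := exp (s * \<sigma>) * p k)"
      have "(\<lambda>i. p i + (if i = k then p k * (exp (s * \<sigma>) - 1) else 0)) sums (1 + p k * (exp (s * \<sigma>) - 1))"
        by (intro sums_add p1 sums_single)
      also have "(\<lambda>i. p i + (if i = k then p k * (exp (s * \<sigma>) - 1) else 0)) = v"
        by (auto simp: v_def fun_eq_iff algebra_simps)
      finally have v: "v sums E" by (simp add: E_def)
      have v_nn: "v i \<ge> 0" for i by (simp add: v_def nn)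
      have Zv: "Zmn v (m n) n \<le> E ^ n"
        using Zmn_le_power_suminf[of v "m n" n] v v_nn by (simp add: sums_iff)
      define A where "A = exp (s * (\<sigma> * p k + \<epsilon>)) ^ n"
      have "prob_BB p (m n) n (\<lambda>y. \<sigma> * (real (Ncount n k y) - p k * real n) > \<epsilon> * real n)
        \<le> Zmn (p(k := exp (s * \<sigma>) * p k)) (m n) n / (A * Zmn p (m n) n)"
      proof (rule prob_BB_Ncount_markov)
        fix y assume "\<epsilon> * real n < \<sigma> * (real (Ncount n k y) - p k * real n)"
        then have "s * (\<epsilon> * real n) \<le> s * (\<sigma> * (real (Ncount n k y) - p k * real n))"
          using s by (intro mult_left_mono) auto
        then have "real n * (s * (\<sigma> * p k + \<epsilon>)) \<le> real (Ncount n k y) * (s * \<sigma>)"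
          by (simp add: algebra_simps)
        then show "A \<le> exp (s * \<sigma>) ^ Ncount n k y"
          unfolding A_def exp_of_nat_mult[symmetric] exp_le_cancel_iff .
      qed (use nn pos in \<open>auto simp: A_def\<close>)
      also have "\<dots> \<le> E ^ n / (A * exp (- \<eta> * real n))"
        using Zv pos elim order_trans[OF Zmn_nonneg[of v "m n" n, OF v_nn] Zv] Zmn_nonneg[of v, OF v_nn] unfolding v_def[symmetric]
        by (intro frac_le mult_left_mono mult_pos_pos) (auto simp: A_def)
      also have "\<dots> = R ^ n * exp (\<eta> * real n)"
        unfolding R_eq A_def minus_mult_left[symmetric] exp_minus[of "_ * _"]
        by (simp add: power_mult_distrib divide_inverse power_inverse mult_ac)
      also have "R ^ n = exp (- 2 * \<eta> * real n)"
        using R by (simp add: \<eta>_def exp_of_nat2_mult)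
      also have "\<dots> * exp (\<eta> * real n) = exp (- \<eta> * real n)" by (simp add: exp_add[symmetric])
      finally show "prob_BB p (m n) n (\<lambda>y. \<epsilon> * real n < \<sigma> * (real (Ncount n k y) - p k * real n)) < \<delta>"
        using elim(2) by linarith
    qed
  qed
qed

lemma Ncount_concentration:
  fixes p :: "nat \<Rightarrow> real"
  assumes nn: "\<And>k. p k \<ge> 0" and p1: "p sums 1"
    and lower: "\<And>\<eta>. \<eta> > 0 \<Longrightarrow> \<forall>\<^sub>F n in sequentially. Zmn p (m n) n > 0 \<longrightarrow> exp (- \<eta> * real n) \<le> Zmn p (m n) n"
    and "\<epsilon> > 0" "\<delta> > 0"
  shows "\<forall>\<^sub>F n in sequentially. Zmn p (m n) n > 0 \<longrightarrow>
     prob_BB p (m n) n (\<lambda>y. \<bar>real (Ncount n k y) / real n - p k\<bar> > \<epsilon>) < \<delta>"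
proof -
  have d2: "\<delta> / 2 > 0" using \<open>\<delta> > 0\<close> by simp
  show ?thesis
    using Ncount_tail[where \<sigma> = 1 and k = k, OF nn p1 lower \<open>\<epsilon> > 0\<close> d2, simplified]
      Ncount_tail[where \<sigma> = "-1" and k = k, OF nn p1 lower \<open>\<epsilon> > 0\<close> d2, simplified]
      eventually_gt_at_top[of 0]
  proof eventually_elim
    case (elim n)
    show ?case
    proof
      assume pos: "Zmn p (m n) n > 0"
      have "prob_BB p (m n) n (\<lambda>y. \<bar>real (Ncount n k y) / real n - p k\<bar> > \<epsilon>)
        \<le> prob_BB p (m n) n (\<lambda>y. \<exists>\<sigma>\<in>{1, -1}. \<sigma> * (real (Ncount n k y) - p k * real n) > \<epsilon> * real n)"
        using elim(3) by (intro prob_BB_mono nn) (auto simp: field_simps abs_if split: if_splits)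
      also have "\<dots> \<le> (\<Sum>\<sigma>\<in>{1, -1}. prob_BB p (m n) n (\<lambda>y. \<sigma> * (real (Ncount n k y) - p k * real n) > \<epsilon> * real n))"
        by (rule prob_BB_bex_le) (auto simp: nn)
      also have "\<dots> < \<delta>" using elim(1,2) pos by simp
      finally show "prob_BB p (m n) n (\<lambda>y. \<bar>real (Ncount n k y) / real n - p k\<bar> > \<epsilon>) < \<delta>" .
    qed
  qed
qed

section \<open>Limit laws concentrated at zero\<close>

text \<open>Boxes with \<open>1\<close> to \<open>K\<close> balls are rare by \<open>small\<close>,
  boxes with more than \<open>K\<close> balls because there are too few balls; nearly all boxes are
  therefore empty.\<close>

lemma Ncount_0_concentration:
  assumes nn: "\<And>k. w k \<ge> 0" and m_lim: "(\<lambda>n. real (m n) / real n) \<longlonglongrightarrow> l"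
    and small: "\<And>k \<epsilon> \<delta>. k \<ge> 1 \<Longrightarrow> \<epsilon> > 0 \<Longrightarrow> \<delta> > 0 \<Longrightarrow> \<forall>\<^sub>F n in sequentially. Zmn w (m n) n > 0 \<longrightarrow>
      prob_BB w (m n) n (\<lambda>y. real (Ncount n k y) > \<epsilon> * real n) < \<delta>"
    and "\<epsilon> > 0" "\<delta> > 0"
  shows "\<forall>\<^sub>F n in sequentially. Zmn w (m n) n > 0 \<longrightarrow>
      prob_BB w (m n) n (\<lambda>y. \<bar>real (Ncount n 0 y) / real n - 1\<bar> > \<epsilon>) < \<delta>"
proof -
  \<comment> \<open>Large enough that, with at most \<open>(l + 1) * n\<close> balls, no more than
    \<open>\<epsilon> / 2 * n\<close> boxes contain more than \<open>K\<close> of them.\<close>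
  obtain K :: nat where K: "2 * (l + 1) / \<epsilon> < real K" using reals_Archimedean2 by blast
  define K' where "K' = real K + 1"
  have K': "K' > 0" "l + 1 \<le> \<epsilon> / 2 * K'" using K \<open>\<epsilon> > 0\<close> by (auto simp: K'_def field_simps)
  have "\<forall>\<^sub>F n in sequentially. \<forall>k\<in>{1..K}. Zmn w (m n) n > 0 \<longrightarrow>
      prob_BB w (m n) n (\<lambda>y. real (Ncount n k y) > \<epsilon> / (2 * K') * real n) < \<delta> / K'"
    using K' \<open>\<epsilon> > 0\<close> \<open>\<delta> > 0\<close> by (intro eventually_ball_finite ballI small) auto
  moreover have "\<forall>\<^sub>F n in sequentially. real (m n) / real n < l + 1"
    using m_lim by (rule order_tendstoD) simp
  ultimately show ?thesis using eventually_gt_at_top[of 0]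
  proof eventually_elim
    case (elim n)
    have m_le: "real (m n) \<le> \<epsilon> / 2 * K' * real n"
    proof -
      have "real (m n) \<le> (l + 1) * real n" using elim by (simp add: field_simps)
      also have "\<dots> \<le> \<epsilon> / 2 * K' * real n" using K' by (intro mult_right_mono) auto
      finally show ?thesis .
    qed
    show ?case
    proof
      assume pos: "Zmn w (m n) n > 0"
      have "\<exists>k\<in>{1..K}. real (Ncount n k y) > \<epsilon> / (2 * K') * real n"
        if y: "y \<in> BB (m n) n" and far: "\<bar>real (Ncount n 0 y) / real n - 1\<bar> > \<epsilon>" for y
      proof (rule ccontr)
        assume "\<not> ?thesis"
        then have "(\<Sum>k=1..K. real (Ncount n k y)) \<le> real (card {1..K}) * (\<epsilon> / (2 * K') * real n)"
          by (intro sum_bounded_above) (auto simp: not_less)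
        also have "\<dots> \<le> K' * (\<epsilon> / (2 * K') * real n)"
          using K' \<open>\<epsilon> > 0\<close> by (intro mult_right_mono) (auto simp: K'_def)
        also have "\<dots> = \<epsilon> / 2 * real n" using K' by simp
        finally have S: "(\<Sum>k=1..K. real (Ncount n k y)) \<le> \<epsilon> / 2 * real n" .
        have "real ((K + 1) * n) \<le> real ((K + 1) * (Ncount n 0 y + (\<Sum>k=1..K. Ncount n k y)) + m n)"
          using Ncount_0_ge[OF y] by (rule of_nat_mono)
        then have "K' * real n \<le> K' * (real (Ncount n 0 y) + (\<Sum>k=1..K. real (Ncount n k y))) + real (m n)"
          by (simp add: K'_def algebra_simps)
        also have "\<dots> \<le> K' * (real (Ncount n 0 y) + \<epsilon> / 2 * real n) + \<epsilon> / 2 * K' * real n"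
          using S K' m_le by (intro add_mono mult_left_mono) auto
        also have "\<dots> = K' * (real (Ncount n 0 y) + \<epsilon> * real n)" by (simp add: algebra_simps)
        finally have "real n \<le> real (Ncount n 0 y) + \<epsilon> * real n" using K' by simp
        then have "1 - real (Ncount n 0 y) / real n \<le> \<epsilon>" using elim(3) by (simp add: field_simps)
        moreover have "real (Ncount n 0 y) / real n \<le> 1" using elim(3) Ncount_le[of n 0 y] by simp
        ultimately show False using far by simp
      qed
      then have "prob_BB w (m n) n (\<lambda>y. \<bar>real (Ncount n 0 y) / real n - 1\<bar> > \<epsilon>)
          \<le> prob_BB w (m n) n (\<lambda>y. \<exists>k\<in>{1..K}. real (Ncount n k y) > \<epsilon> / (2 * K') * real n)"
        by (intro prob_BB_mono nn) auto
      also have "\<dots> \<le> (\<Sum>k=1..K. prob_BB w (m n) n (\<lambda>y. real (Ncount n k y) > \<epsilon> / (2 * K') * real n))"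
        by (intro prob_BB_bex_le nn) auto
      also have "\<dots> \<le> real (card {1..K}) * (\<delta> / K')"
        using elim(1) pos by (intro sum_bounded_above) (blast intro: less_imp_le)
      also have "\<dots> < \<delta>" using K' \<open>\<delta> > 0\<close> by (simp add: K'_def field_simps)
      finally show "prob_BB w (m n) n (\<lambda>y. \<bar>real (Ncount n 0 y) / real n - 1\<bar> > \<epsilon>) < \<delta>" .
    qed
  qed
qed

lemma Ncount_concentration_dirac:
  assumes nn: "\<And>k. w k \<ge> 0" and m_lim: "(\<lambda>n. real (m n) / real n) \<longlonglongrightarrow> l"
    and small: "\<And>k \<epsilon> \<delta>. k \<ge> 1 \<Longrightarrow> \<epsilon> > 0 \<Longrightarrow> \<delta> > 0 \<Longrightarrow> \<forall>\<^sub>F n in sequentially. Zmn w (m n) n > 0 \<longrightarrow>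
      prob_BB w (m n) n (\<lambda>y. real (Ncount n k y) > \<epsilon> * real n) < \<delta>"
    and "\<epsilon> > 0" "\<delta> > 0"
  shows "\<forall>\<^sub>F n in sequentially. Zmn w (m n) n > 0 \<longrightarrow>
      prob_BB w (m n) n (\<lambda>y. \<bar>real (Ncount n k y) / real n - (if k = 0 then 1 else 0)\<bar> > \<epsilon>) < \<delta>"
proof (cases "k = 0")
  case True
  then show ?thesis using Ncount_0_concentration[of w m l, OF nn m_lim small] assms(4,5) by simp
next
  case False
  then have "k \<ge> 1" by simp
  from small[OF this assms(4,5)] eventually_gt_at_top[of 0] show ?thesis
  proof eventually_elim
    case (elim n)
    have "(\<lambda>y. \<bar>real (Ncount n k y) / real n - (if k = 0 then 1 else 0)\<bar> > \<epsilon>)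
        = (\<lambda>y. real (Ncount n k y) > \<epsilon> * real n)"
      using elim(2) False by (auto simp: fun_eq_iff field_simps)
    then show ?case using elim(1) by simp
  qed
qed

lemma Ncount_small_if_few_balls:
  assumes m_lim: "(\<lambda>n. real (m n) / real n) \<longlonglongrightarrow> 0" and "k \<ge> 1" "\<epsilon> > 0" "\<delta> > 0"
  shows "\<forall>\<^sub>F n in sequentially. prob_BB w (m n) n (\<lambda>y. real (Ncount n k y) > \<epsilon> * real n) < \<delta>"
proof -
  have "\<forall>\<^sub>F n in sequentially. real (m n) / real n < \<epsilon>"
    using m_lim by (rule order_tendstoD) (rule \<open>\<epsilon> > 0\<close>)
  then show ?thesis using eventually_gt_at_top[of 0]
  proof eventually_elim
    case (elim n)
    have "real (Ncount n k y) \<le> \<epsilon> * real n" if "y \<in> BB (m n) n" for y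
    proof -
      have "Ncount n k y \<le> k * Ncount n k y" using \<open>k \<ge> 1\<close> by simp
      also have "\<dots> \<le> m n" by (rule Ncount_times_le[OF that])
      finally have "real (Ncount n k y) \<le> real (m n)" by simp
      also have "\<dots> \<le> \<epsilon> * real n" using elim by (simp add: field_simps)
      finally show ?thesis .
    qed
    then have "{y \<in> BB (m n) n. real (Ncount n k y) > \<epsilon> * real n} = {}" by force
    then show ?case using \<open>\<delta> > 0\<close> unfolding prob_BB_def by (metis div_0 sum.empty)
  qed
qed

text \<open>Writing \<open>2 * w k\<close> as \<open>w k + w k\<close>, the binomial theorem marks
  \<open>J\<close> boxes with \<open>k\<close> balls each and leaves the ordinary weights elsewhere.
  The marked boxes can then be exchanged as one block.\<close>

lemma Zmn_fun_upd_double: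
  "Zmn (w(k := 2 * w k)) m n = (\<Sum>J\<le>n. real (n choose J) * w k ^ J * (if J * k \<le> m then Zmn w (m - J * k) (n - J) else 0))"
proof -
  have "Abs_fps (w(k := 2 * w k)) = fps_const (w k) * fps_X ^ k + Abs_fps w"
    by (rule fps_ext) simp
  then have "Abs_fps (w(k := 2 * w k)) ^ n
    = (\<Sum>J\<le>n. of_nat (n choose J) * (fps_const (w k) * fps_X ^ k) ^ J * Abs_fps w ^ (n - J))"
    by (simp add: binomial_ring)
  also have "\<dots> = (\<Sum>J\<le>n. fps_const (real (n choose J) * w k ^ J) * (fps_X ^ (J * k) * Abs_fps w ^ (n - J)))"
    by (simp add: power_mult_distrib power_mult[symmetric] fps_of_nat[symmetric] fps_const_power mult_ac
        fps_const_mult[symmetric] del: fps_const_mult)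
  finally show ?thesis
    by (simp add: Zmn_eq_fps_nth fps_sum_nth fps_X_power_mult_nth not_less if_distrib cong: if_cong)
       (auto intro!: sum.cong)
qed

text \<open>The \<open>J = q j + r\<close> boxes with \<open>k\<close> balls can be replaced by \<open>k j\<close> boxes with \<open>q\<close> balls, \<open>(q - k) j\<close> empty boxes
  and \<open>r\<close> boxes with \<open>k\<close> balls.\<close>

lemma Zmn_exchange:
  assumes nn: "\<And>k. w k \<ge> 0" and q: "k < q" and \<kappa>: "0 < \<kappa>" "\<kappa> \<le> 1"
    and le: "w k ^ q \<le> \<kappa> ^ q * (w q ^ k * w 0 ^ (q - k))"
    and J: "J * k \<le> m" "J \<le> n"
  shows "\<kappa> ^ q * (w k ^ J * Zmn w (m - J * k) (n - J)) \<le> \<kappa> ^ J * Zmn w m n"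
proof -
  define j where "j = J div q"
  define r where "r = J mod q"
  have Jqr: "J = q * j + r" by (simp add: j_def r_def)
  have r: "r < q" using q by (simp add: r_def)
  have "w q ^ (k * j) * w 0 ^ ((q - k) * j) * w k ^ r
     \<le> Zmn w (k * j * q) (k * j) * Zmn w ((q - k) * j * 0) ((q - k) * j) * Zmn w (r * k) r"
    using nn by (intro mult_mono Zmn_replicate) (auto simp: Zmn_nonneg)
  also have "\<dots> \<le> Zmn w (k * j * q + (q - k) * j * 0) (k * j + (q - k) * j) * Zmn w (r * k) r"
    using nn by (intro mult_right_mono Zmn_superadditive Zmn_nonneg)
  also have "\<dots> \<le> Zmn w (k * j * q + (q - k) * j * 0 + r * k) (k * j + (q - k) * j + r)"
    by (intro Zmn_superadditive nn)
  also have "k * j * q + (q - k) * j * 0 + r * k = J * k" by (simp add: Jqr algebra_simps)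
  also have "k * j + (q - k) * j + r = J" using q by (simp add: Jqr add_mult_distrib[symmetric])
  finally have ZJ: "w q ^ (k * j) * w 0 ^ ((q - k) * j) * w k ^ r \<le> Zmn w (J * k) J" .
  have "w k ^ J = (w k ^ q) ^ j * w k ^ r" by (simp add: Jqr power_add power_mult)
  also have "\<dots> \<le> (\<kappa> ^ q * (w q ^ k * w 0 ^ (q - k))) ^ j * w k ^ r"
    using nn by (intro mult_right_mono power_mono le) auto
  also have "\<dots> = \<kappa> ^ (q * j) * (w q ^ (k * j) * w 0 ^ ((q - k) * j) * w k ^ r)"
    by (simp add: power_mult_distrib power_mult)
  also have "\<dots> \<le> \<kappa> ^ (q * j) * Zmn w (J * k) J" using \<kappa> ZJ by (intro mult_left_mono) auto
  finally have "\<kappa> ^ q * w k ^ J \<le> \<kappa> ^ q * (\<kappa> ^ (q * j) * Zmn w (J * k) J)"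
    using \<kappa> by (intro mult_left_mono) auto
  \<comment> \<open>Completes the exponent \<open>q * j\<close> to \<open>J\<close>; the factor
    \<open>\<kappa> ^ q\<close> in the claim pays for the \<open>r < q\<close> boxes that are not
    exchanged.\<close>
  also have "\<dots> \<le> \<kappa> ^ r * (\<kappa> ^ (q * j) * Zmn w (J * k) J)"
    using \<kappa> r nn by (intro mult_right_mono power_decreasing mult_nonneg_nonneg Zmn_nonneg) auto
  also have "\<dots> = \<kappa> ^ J * Zmn w (J * k) J" by (simp add: Jqr power_add mult_ac)
  finally have "\<kappa> ^ q * w k ^ J * Zmn w (m - J * k) (n - J) \<le> \<kappa> ^ J * Zmn w (J * k) J * Zmn w (m - J * k) (n - J)"
    using nn by (intro mult_right_mono Zmn_nonneg)
  also have "\<dots> = \<kappa> ^ J * (Zmn w (J * k) J * Zmn w (m - J * k) (n - J))" by simp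
  also have "\<dots> \<le> \<kappa> ^ J * Zmn w (J * k + (m - J * k)) (J + (n - J))"
    using \<kappa> nn by (intro mult_left_mono Zmn_superadditive) auto
  finally show ?thesis using J by (simp add: mult_ac)
qed

text \<open>If no \<open>q\<close> worked, \<open>w q\<close> would grow at most geometrically and
  the radius of convergence would be positive. The two sides compare two ways of placing
  \<open>k * q\<close> balls in \<open>q\<close> boxes.\<close>

lemma exists_heavy_weight:
  fixes w :: "nat \<Rightarrow> real"
  assumes nn: "\<And>k. w k \<ge> 0" and w0: "w 0 > 0" and rad: "conv_radius w = 0" and k: "k \<ge> 1" and \<kappa>: "\<kappa> > 0"
  shows "\<exists>q>k. w k ^ q \<le> \<kappa> ^ q * (w q ^ k * w 0 ^ (q - k))"
proof (rule ccontr)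
  assume none: "\<not> ?thesis"
  have *: "\<kappa> ^ q * (w q ^ k * w 0 ^ (q - k)) < w k ^ q" if "q > k" for q
  proof (rule ccontr)
    assume "\<not> ?thesis"
    then have "w k ^ q \<le> \<kappa> ^ q * (w q ^ k * w 0 ^ (q - k))" by (rule leI)
    with that none show False by blast
  qed
  \<comment> \<open>Ensures \<open>r ^ k \<ge> w k / (\<kappa> * w 0)\<close>; the
    \<open>+ 1\<close> keeps \<open>r\<close> positive when \<open>w k = 0\<close>.\<close>
  define r where "r = root k (w k / (\<kappa> * w 0)) + 1"
  have r: "r > 0" using nn w0 \<kappa> k by (simp add: r_def add_nonneg_pos)
  have bound: "w q \<le> w 0 * r ^ q" if "q > k" for q
  proof -
    have "w k / (\<kappa> * w 0) = root k (w k / (\<kappa> * w 0)) ^ k"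
      using k nn[of k] w0 \<kappa> by (intro real_root_pow_pos2[symmetric]) auto
    also have "\<dots> \<le> r ^ k" using nn w0 \<kappa> k by (intro power_mono) (auto simp: r_def)
    finally have "(w k / (\<kappa> * w 0)) ^ q \<le> (r ^ k) ^ q" using nn w0 \<kappa> by (intro power_mono) auto
    then have "w 0 ^ k * (w k / (\<kappa> * w 0)) ^ q \<le> w 0 ^ k * (r ^ k) ^ q"
      using w0 by (intro mult_left_mono) auto
    moreover have "w q ^ k \<le> w 0 ^ k * (w k / (\<kappa> * w 0)) ^ q"
    proof -
      have "w 0 ^ q = w 0 ^ (q - k) * w 0 ^ k" using that by (simp add: power_add[symmetric])
      then show ?thesis using *[OF that] w0 \<kappa> by (simp add: power_divide power_mult_distrib pos_le_divide_eq mult_ac)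
    qed
    ultimately have "w q ^ k \<le> w 0 ^ k * (r ^ k) ^ q"
      by linarith
    also have "\<dots> = (w 0 * r ^ q) ^ k"
      by (simp only: power_mult_distrib power_mult[symmetric] mult.commute[of q k])
    finally show ?thesis
      using k r w0 nn[of q] by (subst (asm) power_mono_iff) auto
  qed
  define z where "z = 1 / (2 * r)"
  have "summable (\<lambda>q. w q * z ^ q)"
  proof (rule summable_comparison_test_ev)
    show "\<forall>\<^sub>F q in sequentially. norm (w q * z ^ q) \<le> w 0 * (1 / 2) ^ q"
      using eventually_gt_at_top[of k]
    proof eventually_elim
      case (elim q)
      have "w q * z ^ q \<le> w 0 * r ^ q * z ^ q" using bound[OF elim] r by (intro mult_right_mono) (auto simp: z_def)
      also have "\<dots> = w 0 * (1 / 2) ^ q" using r by (simp add: z_def power_divide power_mult_distrib)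
      finally show ?case using nn r by (simp add: z_def)
    qed
    show "summable (\<lambda>q. w 0 * (1 / 2) ^ q)" by (intro summable_mult summable_geometric) simp
  qed
  from conv_radius_geI[OF this] have "ereal (norm z) \<le> 0" using rad by simp
  then show False using r by (simp add: z_def)
qed

text \<open>The exchange bounds the mean of \<open>2 ^ Ncount n k y\<close> by
  \<open>(1 + \<kappa>) ^ n / \<kappa> ^ q\<close>; Markov's inequality sets this against
  \<open>exp (\<epsilon> * ln 2 * n)\<close>.\<close>

lemma Ncount_small_if_conv_radius_0:
  assumes nn: "\<And>k. w k \<ge> 0" and w0: "w 0 > 0" and rad: "conv_radius w = 0" and k: "k \<ge> 1"
    and eps: "\<epsilon> > 0" and "\<delta> > 0"
  shows "\<forall>\<^sub>F n in sequentially. Zmn w (m n) n > 0 \<longrightarrow>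
      prob_BB w (m n) n (\<lambda>y. real (Ncount n k y) > \<epsilon> * real n) < \<delta>"
proof -
  \<comment> \<open>Keeps \<open>\<kappa>\<close> below \<open>\<epsilon> * ln 2\<close>, so that
    the decay rate \<open>d\<close> is positive.\<close>
  define \<kappa> where "\<kappa> = min 1 (\<epsilon> * ln 2 / 2)"
  have \<kappa>: "0 < \<kappa>" "\<kappa> \<le> 1" using eps by (auto simp: \<kappa>_def)
  have \<kappa>2: "\<kappa> \<le> \<epsilon> * ln 2 / 2" unfolding \<kappa>_def by (rule min.cobounded2)
  have dpos: "\<epsilon> * ln 2 - \<kappa> > 0"
  proof -
    have "\<epsilon> * ln 2 > 0" using eps by simp
    with \<kappa>2 show ?thesis by linarith
  qed
  from exists_heavy_weight[OF nn w0 rad k \<kappa>(1)] obtain q where q: "k < q"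
    "w k ^ q \<le> \<kappa> ^ q * (w q ^ k * w 0 ^ (q - k))" by blast
  define d where "d = \<epsilon> * ln 2 - \<kappa>"
  have d: "d > 0" using dpos by (simp add: d_def)
  have "(\<lambda>n. exp (- d * real n) / \<kappa> ^ q) \<longlonglongrightarrow> 0 / \<kappa> ^ q"
    by (intro tendsto_divide tendsto_const) (use d \<kappa> in \<open>real_asymp | simp\<close>)+
  then have "\<forall>\<^sub>F n in sequentially. exp (- d * real n) / \<kappa> ^ q < \<delta>"
    by (rule order_tendstoD) (use \<open>\<delta> > 0\<close> in simp)
  then show ?thesis
  proof eventually_elim
    case (elim n)
    show ?case
    proof
      assume pos: "Zmn w (m n) n > 0"
      have "\<kappa> ^ q * Zmn (w(k := 2 * w k)) (m n) n \<le> (\<Sum>J\<le>n. real (n choose J) * (\<kappa> ^ J * Zmn w (m n) n))"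
        unfolding Zmn_fun_upd_double sum_distrib_left
      proof (rule sum_mono)
        fix J assume "J \<in> {..n}"
        then have "J \<le> n" by simp
        show "\<kappa> ^ q * (real (n choose J) * w k ^ J * (if J * k \<le> m n then Zmn w (m n - J * k) (n - J) else 0))
            \<le> real (n choose J) * (\<kappa> ^ J * Zmn w (m n) n)"
        proof (cases "J * k \<le> m n")
          case True
          from mult_left_mono[OF Zmn_exchange[OF nn q(1) \<kappa> q(2) True \<open>J \<le> n\<close>], of "real (n choose J)"]
          show ?thesis using True by (simp add: mult_ac)
        next
          case False
          then show ?thesis using \<kappa> pos by simp
        qed
      qed
      also have "\<dots> = (\<Sum>J\<le>n. real (n choose J) * \<kappa> ^ J * 1 ^ (n - J)) * Zmn w (m n) n"
        by (simp add: sum_distrib_right mult.assoc)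
      also have "\<dots> = (\<kappa> + 1) ^ n * Zmn w (m n) n" by (simp only: binomial_ring)
      also have "\<dots> \<le> exp \<kappa> ^ n * Zmn w (m n) n"
        using \<kappa> pos exp_ge_add_one_self[of \<kappa>] by (intro mult_right_mono power_mono) (auto simp: add.commute)
      finally have Z2: "Zmn (w(k := 2 * w k)) (m n) n \<le> exp \<kappa> ^ n * Zmn w (m n) n / \<kappa> ^ q"
        using \<kappa> by (simp add: field_simps)
      have "prob_BB w (m n) n (\<lambda>y. real (Ncount n k y) > \<epsilon> * real n)
        \<le> Zmn (w(k := 2 * w k)) (m n) n / (exp (\<epsilon> * ln 2 * real n) * Zmn w (m n) n)"
      proof (rule prob_BB_Ncount_markov)
        fix y assume "\<epsilon> * real n < real (Ncount n k y)"
        then have "\<epsilon> * real n * ln 2 \<le> real (Ncount n k y) * ln 2"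
          by (intro mult_right_mono) auto
        then have "exp (\<epsilon> * ln 2 * real n) \<le> exp (real (Ncount n k y) * ln 2)" by (simp add: mult_ac)
        also have "\<dots> = 2 ^ Ncount n k y" by (simp add: exp_of_nat_mult)
        finally show "exp (\<epsilon> * ln 2 * real n) \<le> 2 ^ Ncount n k y" .
      qed (use nn pos in auto)
      also have "\<dots> \<le> (exp \<kappa> ^ n * Zmn w (m n) n / \<kappa> ^ q) / (exp (\<epsilon> * ln 2 * real n) * Zmn w (m n) n)"
        using Z2 pos by (intro divide_right_mono) auto
      also have "\<dots> = exp (real n * \<kappa>) / exp (\<epsilon> * ln 2 * real n) / \<kappa> ^ q"
        using pos by (simp add: exp_of_nat_mult)
      also have "\<dots> = exp (- d * real n) / \<kappa> ^ q"
        unfolding exp_diff[symmetric] d_def by (simp add: algebra_simps)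
      finally show "prob_BB w (m n) n (\<lambda>y. real (Ncount n k y) > \<epsilon> * real n) < \<delta>"
        using elim by linarith
    qed
  qed
qed

section \<open>Power series with nonnegative coefficients\<close>

text \<open>Finite partial sums are continuous and bound the series from below. Both the convergent
  and the divergent case at \<open>T\<close> rest on this.\<close>

lemma partial_sum_gt_near_left:
  fixes a :: "nat \<Rightarrow> real"
  assumes nn: "\<And>k. a k \<ge> 0" and "T > 0" and sm: "\<And>s. 0 \<le> s \<Longrightarrow> s < T \<Longrightarrow> summable (\<lambda>k. a k * s ^ k)"
    and c: "c < (\<Sum>k<N. a k * T ^ k)"
  shows "\<forall>\<^sub>F s in at_left T. c < (\<Sum>k. a k * s ^ k)"
proof -
  have "((\<lambda>s. \<Sum>k<N. a k * s ^ k) \<longlongrightarrow> (\<Sum>k<N. a k * T ^ k)) (at_left T)"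
    by (intro tendsto_intros)
  then have "\<forall>\<^sub>F s in at_left T. c < (\<Sum>k<N. a k * s ^ k)"
    using c by (rule order_tendstoD)
  then show ?thesis using eventually_at_left_real[OF \<open>T > 0\<close>]
  proof eventually_elim
    case (elim s)
    have "(\<Sum>k<N. a k * s ^ k) \<le> (\<Sum>k. a k * s ^ k)"
      using elim nn by (intro sum_le_suminf sm) auto
    with elim show ?case by simp
  qed
qed

text \<open>Abel's limit theorem for nonnegative coefficients: partial sums give the lower bound,
  termwise monotonicity the upper one.\<close>

lemma power_series_tendsto_at_left:
  fixes a :: "nat \<Rightarrow> real"
  assumes nn: "\<And>k. a k \<ge> 0" and "T > 0" and sT: "summable (\<lambda>k. a k * T ^ k)"
  shows "((\<lambda>s. \<Sum>k. a k * s ^ k) \<longlongrightarrow> (\<Sum>k. a k * T ^ k)) (at_left T)"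
proof -
  have sm: "summable (\<lambda>k. a k * s ^ k)" if "0 \<le> s" "s < T" for s
    using that nn by (intro summable_comparison_test'[OF sT, of 0]) (auto intro!: mult_left_mono power_mono)
  show ?thesis
  proof (rule order_tendstoI)
    fix c assume "c < (\<Sum>k. a k * T ^ k)"
    then obtain N where "c < (\<Sum>k<N. a k * T ^ k)"
      using order_tendstoD(1)[OF summable_LIMSEQ[OF sT]] by (auto simp: eventually_sequentially)
    then show "\<forall>\<^sub>F s in at_left T. c < (\<Sum>k. a k * s ^ k)"
      using nn \<open>T > 0\<close> sm by (intro partial_sum_gt_near_left)
  next
    fix c assume c: "(\<Sum>k. a k * T ^ k) < c"
    show "\<forall>\<^sub>F s in at_left T. (\<Sum>k. a k * s ^ k) < c"
      using eventually_at_left_real[OF \<open>T > 0\<close>]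
    proof eventually_elim
      case (elim s)
      have "(\<Sum>k. a k * s ^ k) \<le> (\<Sum>k. a k * T ^ k)"
        using elim nn by (intro suminf_le sm sT mult_left_mono power_mono) auto
      with c show ?case by simp
    qed
  qed
qed

lemma power_series_at_top_at_left:
  fixes a :: "nat \<Rightarrow> real"
  assumes nn: "\<And>k. a k \<ge> 0" and "T > 0" and sm: "\<And>s. 0 \<le> s \<Longrightarrow> s < T \<Longrightarrow> summable (\<lambda>k. a k * s ^ k)"
    and nsT: "\<not> summable (\<lambda>k. a k * T ^ k)"
  shows "filterlim (\<lambda>s. \<Sum>k. a k * s ^ k) at_top (at_left T)"
  unfolding filterlim_at_top_dense
proof
  fix c :: real
  have "\<exists>N. c < (\<Sum>k<N. a k * T ^ k)"
  proof (rule ccontr)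
    assume "\<not> ?thesis"
    then have "(\<Sum>k\<le>n. a k * T ^ k) \<le> c" for n
      by (metis lessThan_Suc_atMost not_less)
    then have "summable (\<lambda>k. a k * T ^ k)"
      using nn \<open>T > 0\<close> by (intro bounded_imp_summable[where B = c]) auto
    with nsT show False by simp
  qed
  then show "\<forall>\<^sub>F s in at_left T. c < (\<Sum>k. a k * s ^ k)"
    using nn \<open>T > 0\<close> sm by (blast intro: partial_sum_gt_near_left)
qed

lemma suminf_ereal_eq_infinity:
  fixes f :: "nat \<Rightarrow> real"
  assumes "\<And>k. f k \<ge> 0" "\<not> summable f"
  shows "(\<Sum>k. ereal (f k)) = \<infinity>"
proof (rule ccontr)
  assume "\<not> ?thesis"
  then have "summable f"
    using assms by (intro summable_ereal) auto
  with assms show False by simp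
qed

section \<open>The functions \<open>\<Phi>\<close> and \<open>\<Psi>\<close>\<close>

locale weight_seq =
  fixes w :: "nat \<Rightarrow> real"
  assumes w_nonneg: "w k \<ge> 0" and w0: "w 0 > 0" and w_nontrivial: "\<exists>k\<ge>1. w k > 0"
begin

text \<open>The operator \<open>t * d/dt\<close> applied \<open>j\<close> times to
  \<open>Phi w\<close>. For \<open>j = 0\<close> the term at \<open>k = 0\<close> is
  \<open>w 0\<close>, because \<open>0 ^ 0 = 1\<close>.\<close>

definition moment :: "nat \<Rightarrow> real \<Rightarrow> real" where
  "moment j t = (\<Sum>k. real k ^ j * w k * t ^ k)"

lemma Phi_eq_moment: "Phi w t = moment 0 t"
  by (simp add: Phi_def moment_def)

lemma Psi_eq_moment: "Psi w t = moment 1 t / moment 0 t"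
  by (simp add: Psi_def moment_def Phi_eq_moment)

text \<open>Differentiation lowers the exponent of \<open>t\<close> and multiplication by
  \<open>t\<close> restores it, so \<open>t * D\<close> stays within the family
  \<open>moment\<close>, without division at \<open>t = 0\<close>. Summability for
  \<open>Suc j\<close> comes from the differentiated series for \<open>j\<close>.\<close>

lemma
  assumes "ereal \<bar>t\<bar> < conv_radius w"
  shows summable_moment: "summable (\<lambda>k. real k ^ j * w k * t ^ k)"
    and DERIV_moment_ex: "\<exists>D. (moment j has_real_derivative D) (at t) \<and> t * D = moment (Suc j) t"
proof -
  have step: "\<exists>D. (moment j has_real_derivative D) (at t)
      \<and> (\<lambda>k. real k ^ Suc j * w k * t ^ k) sums (t * D)"
    if sm: "\<And>t. ereal \<bar>t\<bar> < conv_radius w \<Longrightarrow> summable (\<lambda>k. real k ^ j * w k * t ^ k)"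
      and t: "ereal \<bar>t\<bar> < conv_radius w" for j t
  proof -
    define c where "c = (\<lambda>k. real k ^ j * w k)"
    obtain K where K: "\<bar>t\<bar> < K" "ereal K < conv_radius w"
      using ereal_dense2[OF t] by auto
    have cK: "summable (\<lambda>k. c k * x ^ k)" if "norm x < K" for x
    proof -
      have "ereal \<bar>x\<bar> \<le> ereal K" using that by simp
      then have "ereal \<bar>x\<bar> < conv_radius w" using K(2) by (rule order.strict_trans1)
      then show ?thesis using sm unfolding c_def by blast
    qed
    define D where "D = (\<Sum>k. diffs c k * t ^ k)"
    obtain K' where K': "\<bar>t\<bar> < K'" "K' < K" using dense[OF K(1)] by auto
    have "(moment j has_real_derivative D) (at t)"
      unfolding moment_def[abs_def] D_def c_def[symmetric]
      using termdiffs_strong[of c K' t] cK[of K'] K' by (simp add: c_def)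
    moreover have "(\<lambda>k. real k ^ Suc j * w k * t ^ k) sums (t * D)"
    proof -
      have "summable (\<lambda>k. diffs c k * t ^ k)"
        by (rule termdiff_converges[of t K]) (use K(1) cK in auto)
      from sums_mult[OF diffs_equiv[OF this], of t]
      have "(\<lambda>k. t * (of_nat k * c k * t ^ (k - Suc 0))) sums (t * D)" by (simp add: D_def)
      moreover have "t * (of_nat k * c k * t ^ (k - Suc 0)) = real k ^ Suc j * w k * t ^ k" for k
        by (cases k) (auto simp: c_def)
      ultimately show ?thesis by simp
    qed
    ultimately show ?thesis by blast
  qed
  have sm: "summable (\<lambda>k. real k ^ j * w k * t ^ k)" if "ereal \<bar>t\<bar> < conv_radius w" for j t
    using that
  proof (induction j arbitrary: t)
    case 0
    then show ?case using summable_in_conv_radius[of t w] by simp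
  next
    case (Suc j)
    from step[OF Suc.IH Suc.prems] show ?case by (auto simp: sums_iff)
  qed
  then show "summable (\<lambda>k. real k ^ j * w k * t ^ k)" using assms by blast
  from step[OF sm assms, of j] obtain D where D: "(moment j has_real_derivative D) (at t)"
    "(\<lambda>k. real k ^ Suc j * w k * t ^ k) sums (t * D)" by blast
  from sums_unique[OF D(2)] have "t * D = moment (Suc j) t" unfolding moment_def .
  with D(1) show "\<exists>D. (moment j has_real_derivative D) (at t) \<and> t * D = moment (Suc j) t" by blast
qed

lemma moment_0_pos:
  assumes "summable (\<lambda>k. w k * t ^ k)" "t \<ge> 0"
  shows "moment 0 t > 0"
proof -
  have "0 < (\<Sum>k. w k * t ^ k)"
    by (rule suminf_pos2[where i = 0]) (use assms w_nonneg w0 in auto)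
  then show ?thesis by (simp add: moment_def)
qed

lemma variance_sums:
  assumes "summable (\<lambda>k. w k * t ^ k)" "summable (\<lambda>k. real k * w k * t ^ k)" "summable (\<lambda>k. (real k)\<^sup>2 * w k * t ^ k)" "t \<ge> 0"
  shows "(\<lambda>k. (real k - Psi w t)\<^sup>2 * (w k * t ^ k)) sums (moment 0 t * (moment 2 t / moment 0 t - (Psi w t)\<^sup>2))"
proof -
  define \<mu> where "\<mu> = Psi w t"
  have M: "moment (Suc 0) t = \<mu> * moment 0 t" using moment_0_pos[OF assms(1,4)] by (simp add: \<mu>_def Psi_eq_moment)
  have "(\<lambda>k. (real k)\<^sup>2 * w k * t ^ k - 2 * \<mu> * (real k * w k * t ^ k) + \<mu>\<^sup>2 * (w k * t ^ k))
      sums (moment 2 t - 2 * \<mu> * moment 1 t + \<mu>\<^sup>2 * moment 0 t)"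
    using assms by (intro sums_add sums_diff sums_mult) (auto simp: moment_def summable_sums)
  also have "(\<lambda>k. (real k)\<^sup>2 * w k * t ^ k - 2 * \<mu> * (real k * w k * t ^ k) + \<mu>\<^sup>2 * (w k * t ^ k))
     = (\<lambda>k. (real k - \<mu>)\<^sup>2 * (w k * t ^ k))"
    by (auto simp: fun_eq_iff power2_eq_square algebra_simps)
  also have "moment 2 t - 2 * \<mu> * moment 1 t + \<mu>\<^sup>2 * moment 0 t = moment 0 t * (moment 2 t / moment 0 t - \<mu>\<^sup>2)"
    using moment_0_pos[OF assms(1,4)] by (simp add: M field_simps power2_eq_square)
  finally show ?thesis by (simp add: \<mu>_def)
qed

lemma summable_inside:
  assumes "0 \<le> t" "ereal t < conv_radius w"
  shows "summable (\<lambda>k. w k * t ^ k)" "summable (\<lambda>k. real k * w k * t ^ k)" "summable (\<lambda>k. (real k)\<^sup>2 * w k * t ^ k)"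
  using summable_moment[of t 0] summable_moment[of t 1] summable_moment[of t 2] assms by auto

text \<open>Quotient rule, multiplied by \<open>t\<close> so that derivatives of moments become
  moments; the right-hand side is the variance of the tilted distribution.\<close>

lemma DERIV_Psi:
  assumes "0 \<le> t" "ereal t < conv_radius w"
  shows "(Psi w has_real_derivative deriv (Psi w) t) (at t)"
    and "t * deriv (Psi w) t = moment 2 t / moment 0 t - (Psi w t)\<^sup>2"
proof -
  have t: "ereal \<bar>t\<bar> < conv_radius w" using assms by simp
  obtain D0 D1 where D: "(moment 0 has_real_derivative D0) (at t)" "t * D0 = moment 1 t"
    "(moment 1 has_real_derivative D1) (at t)" "t * D1 = moment 2 t"
    using DERIV_moment_ex[OF t, of 0] DERIV_moment_ex[OF t, of 1] by (auto simp: numeral_2_eq_2)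
  have pos: "moment 0 t > 0" using moment_0_pos summable_inside assms by blast
  have *: "(Psi w has_real_derivative ((D1 * moment 0 t - moment 1 t * D0) / (moment 0 t * moment 0 t))) (at t)"
    unfolding Psi_eq_moment[abs_def] using pos by (intro DERIV_divide D) auto
  then have eq: "deriv (Psi w) t = (D1 * moment 0 t - moment 1 t * D0) / (moment 0 t * moment 0 t)"
    by (rule DERIV_imp_deriv)
  with * show "(Psi w has_real_derivative deriv (Psi w) t) (at t)" by simp
  have "t * deriv (Psi w) t = ((t * D1) * moment 0 t - moment 1 t * (t * D0)) / (moment 0 t * moment 0 t)"
    by (simp add: eq algebra_simps)
  also have "\<dots> = moment 2 t / moment 0 t - (Psi w t)\<^sup>2"
    unfolding D using pos by (simp add: Psi_eq_moment power2_eq_square field_simps)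
  finally show "t * deriv (Psi w) t = moment 2 t / moment 0 t - (Psi w t)\<^sup>2" .
qed

text \<open>The derivative is a variance divided by \<open>x\<close>. It is positive because the
  weights at 0 and at some \<open>k \<ge> 1\<close> are positive, and one of these points differs
  from the mean.\<close>

lemma Psi_strict_mono:
  assumes "0 \<le> s" "s < t" "ereal t < conv_radius w"
  shows "Psi w s < Psi w t"
proof (rule DERIV_pos_imp_increasing_open[OF assms(2)])
  have inside: "ereal x < conv_radius w" if "x \<le> t" for x
    by (rule order.strict_trans1[OF _ assms(3)]) (use that in simp)
  fix x assume x: "s < x" "x < t"
  then have x': "0 \<le> x" "0 < x" "ereal x < conv_radius w" using assms inside by auto
  note sm = summable_inside[OF x'(1,3)]
  note V = variance_sums[OF sm x'(1)]
  have "\<exists>k. 0 < (real k - Psi w x)\<^sup>2 * (w k * x ^ k)"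
  proof (cases "Psi w x = 0")
    case True
    obtain k where "k \<ge> 1" "w k > 0" using w_nontrivial by blast
    then show ?thesis using True x' by (intro exI[of _ k]) simp
  next
    case False
    then show ?thesis using w0 by (intro exI[of _ 0]) simp
  qed
  then obtain k where "0 < (real k - Psi w x)\<^sup>2 * (w k * x ^ k)" by blast
  then have "0 < (\<Sum>k. (real k - Psi w x)\<^sup>2 * (w k * x ^ k))"
    using V x' w_nonneg by (intro suminf_pos2) (auto simp: sums_iff)
  then have "0 < x * deriv (Psi w) x"
    using V moment_0_pos[OF sm(1) x'(1)] DERIV_Psi(2)[OF x'(1,3)] by (simp add: sums_iff zero_less_mult_iff)
  then have "0 < deriv (Psi w) x" using x' by (simp add: zero_less_mult_iff)
  then show "\<exists>y. (Psi w has_real_derivative y) (at x) \<and> 0 < y"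
    using DERIV_Psi(1)[OF x'(1,3)] by blast
next
  have "isCont (Psi w) x" if "s \<le> x" "x \<le> t" for x
  proof -
    have "ereal x < conv_radius w"
      by (rule order.strict_trans1[OF _ assms(3)]) (use that in simp)
    then show ?thesis using DERIV_Psi(1)[of x] that assms by (auto intro: DERIV_isCont)
  qed
  then show "continuous_on {s..t} (Psi w)" by (auto intro!: continuous_at_imp_continuous_on)
qed

lemma Psi_intermediate:
  assumes "0 \<le> t" "ereal t < conv_radius w" "0 \<le> l" "l \<le> Psi w t"
  obtains s where "0 \<le> s" "s \<le> t" "Psi w s = l"
proof -
  have "continuous_on {0..t} (Psi w)"
  proof (rule continuous_at_imp_continuous_on, rule ballI)
    fix x assume "x \<in> {0..t}"
    then have "0 \<le> x" "ereal x < conv_radius w"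
      using assms(2) by (auto intro: order.strict_trans1[of _ "ereal t"])
    then show "isCont (Psi w) x" using DERIV_Psi(1) by (blast intro: DERIV_isCont)
  qed
  moreover have "Psi w 0 = 0" by (simp add: Psi_eq_moment moment_def)
  ultimately show thesis using IVT'[of "Psi w" 0 l t] assms that by auto
qed

lemma Psi_at_inside:
  assumes "0 \<le> t" "ereal t < conv_radius w"
  shows "Psi_at w t = ereal (Psi w t)"
proof -
  note sm = summable_inside[OF assms]
  have "(\<Sum>k. ereal (real k * w k * t ^ k)) = ereal (moment 1 t)"
    using sums_ereal[THEN iffD2, OF summable_sums[OF sm(2)]] by (simp add: moment_def sums_iff)
  then show ?thesis using sm(1) moment_0_pos[OF sm(1) assms(1)]
    by (simp add: Psi_at_def Phi_eq_moment Psi_eq_moment)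
qed

text \<open>Balls in boxes with at least \<open>B\<close> balls contribute at least \<open>B\<close> each; the remaining deficit is a polynomial.\<close>

lemma Psi_ge:
  assumes "0 \<le> t" "ereal t < conv_radius w"
  shows "real B - (\<Sum>k<B. real B * (w k * t ^ k)) / moment 0 t \<le> Psi w t"
proof -
  note sm = summable_inside[OF assms]
  have pos: "moment 0 t > 0" by (rule moment_0_pos[OF sm(1) assms(1)])
  have lo: "(\<lambda>k. real B * (w k * t ^ k) - (if k < B then real B * (w k * t ^ k) else 0)) sums
     (real B * moment 0 t - (\<Sum>k<B. real B * (w k * t ^ k)))"
  proof (intro sums_diff sums_mult)
    show "(\<lambda>k. w k * t ^ k) sums moment 0 t" using sm(1) by (simp add: moment_def summable_sums)
    show "(\<lambda>k. if k < B then real B * (w k * t ^ k) else 0) sums (\<Sum>k<B. real B * (w k * t ^ k))"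
      using sums_If_finite_set[of "{..<B}" "\<lambda>k. real B * (w k * t ^ k)"] by simp
  qed
  have hi: "(\<lambda>k. real k * w k * t ^ k) sums moment 1 t" using sm(2) by (simp add: moment_def summable_sums)
  have "real B * (w k * t ^ k) - (if k < B then real B * (w k * t ^ k) else 0) \<le> real k * w k * t ^ k" for k
    using w_nonneg[of k] assms(1) by (auto simp: mult.assoc intro!: mult_right_mono)
  from sums_le[OF this lo hi] have "real B * moment 0 t - (\<Sum>k<B. real B * (w k * t ^ k)) \<le> moment 1 t" .
  from divide_right_mono[OF this less_imp_le[OF pos]] show ?thesis
    using pos by (simp add: Psi_eq_moment diff_divide_distrib)
qed

section \<open>Behaviour at the radius of convergence\<close>

lemma summable_at_left:
  assumes "conv_radius w = ereal T" "0 \<le> s" "s < T"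
  shows "summable (\<lambda>k. real k ^ j * w k * s ^ k)"
  by (rule summable_moment) (use assms in simp)

lemma moment_tendsto_at_left:
  assumes "T > 0" "summable (\<lambda>k. real k ^ j * w k * T ^ k)"
  shows "(moment j \<longlongrightarrow> moment j T) (at_left T)"
  unfolding moment_def[abs_def]
  by (rule power_series_tendsto_at_left) (use assms w_nonneg in auto)

lemma moment_at_top_at_left:
  assumes "T > 0" "conv_radius w = ereal T" "\<not> summable (\<lambda>k. real k ^ j * w k * T ^ k)"
  shows "filterlim (moment j) at_top (at_left T)"
  unfolding moment_def[abs_def]
  by (rule power_series_at_top_at_left) (use assms w_nonneg summable_at_left in auto)

text \<open>\<open>Psi_ge\<close> holds for every \<open>B\<close>, and its subtracted quotient is
  at most 1 once \<open>Phi w\<close> exceeds the value \<open>C\<close> of the deficit polynomial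
  at \<open>T\<close>.\<close>

lemma Psi_tendsto_infinity:
  assumes T: "T > 0" "conv_radius w = ereal T" and ns: "\<not> summable (\<lambda>k. w k * T ^ k)"
  shows "((\<lambda>s. ereal (Psi w s)) \<longlongrightarrow> \<infinity>) (at_left T)"
  unfolding tendsto_PInfty
proof
  fix r :: real
  obtain B :: nat where B: "r + 1 < real B" using reals_Archimedean2 by blast
  define C where "C = (\<Sum>k<B. real B * (w k * T ^ k))"
  have "filterlim (moment 0) at_top (at_left T)"
    using moment_at_top_at_left[OF T, of 0] ns by simp
  then have "\<forall>\<^sub>F s in at_left T. C < moment 0 s" by (simp add: filterlim_at_top_dense)
  then show "\<forall>\<^sub>F s in at_left T. ereal r < ereal (Psi w s)"
    using eventually_at_left_real[OF T(1)]
  proof eventually_elim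
    case (elim s)
    then have s: "0 \<le> s" "ereal s < conv_radius w" using T by auto
    have pos: "moment 0 s > 0" using moment_0_pos summable_inside(1) s by blast
    have "(\<Sum>k<B. real B * (w k * s ^ k)) \<le> C"
      unfolding C_def using elim w_nonneg by (intro sum_mono mult_left_mono power_mono) auto
    then have "(\<Sum>k<B. real B * (w k * s ^ k)) / moment 0 s \<le> 1" using pos elim by simp
    with Psi_ge[OF s, of B] B show ?case by simp
  qed
qed

lemma Psi_at_not_summable:
  assumes T: "T > 0" "conv_radius w = ereal T" and ns: "\<not> summable (\<lambda>k. w k * T ^ k)"
  shows "Psi_at w T = \<infinity>"
  using tendsto_Lim[OF _ Psi_tendsto_infinity[OF assms]] ns by (simp add: Psi_at_def)

text \<open>At \<open>T\<close> either \<open>Phi\<close> diverges, or only the numerator does, or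
  both series converge. In each case the value at the radius is a limit from inside, where calculus
  applies.\<close>

lemma Psi_tendsto_Psi_at:
  assumes T: "T > 0" "conv_radius w = ereal T"
  shows "((\<lambda>s. ereal (Psi w s)) \<longlongrightarrow> Psi_at w T) (at_left T)"
proof (cases "summable (\<lambda>k. w k * T ^ k)")
  case False
  then show ?thesis using Psi_tendsto_infinity[OF T] Psi_at_not_summable[OF T] by simp
next
  case sm0: True
  have pos: "moment 0 T > 0" using moment_0_pos[OF sm0] T by simp
  have lim0: "(moment 0 \<longlongrightarrow> moment 0 T) (at_left T)"
    using moment_tendsto_at_left[OF T(1), of 0] sm0 by simp
  show ?thesis
  proof (cases "summable (\<lambda>k. real k * w k * T ^ k)")
    case True
    have "(\<Sum>k. ereal (real k * w k * T ^ k)) = ereal (moment 1 T)"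
      using sums_ereal[THEN iffD2, OF summable_sums[OF True]] by (simp add: moment_def sums_iff)
    then have "Psi_at w T = ereal (moment 1 T / moment 0 T)"
      using sm0 pos by (simp add: Psi_at_def Phi_eq_moment)
    moreover have "((\<lambda>s. ereal (Psi w s)) \<longlongrightarrow> ereal (moment 1 T / moment 0 T)) (at_left T)"
      unfolding Psi_eq_moment using moment_tendsto_at_left[OF T(1), of 1] True pos lim0
      by (intro tendsto_ereal tendsto_divide) auto
    ultimately show ?thesis by simp
  next
    case False
    have "(\<Sum>k. ereal (real k * w k * T ^ k)) = \<infinity>"
      using False T w_nonneg by (intro suminf_ereal_eq_infinity) auto
    then have "Psi_at w T = \<infinity>" using sm0 pos by (simp add: Psi_at_def Phi_eq_moment)
    moreover have "filterlim (\<lambda>s. inverse (moment 0 s) * moment 1 s) at_top (at_left T)"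
    proof (rule filterlim_tendsto_pos_mult_at_top)
      show "((\<lambda>s. inverse (moment 0 s)) \<longlongrightarrow> inverse (moment 0 T)) (at_left T)"
        using lim0 pos by (intro tendsto_inverse) auto
      show "filterlim (moment 1) at_top (at_left T)"
        using moment_at_top_at_left[OF T, of 1] False by simp
    qed (use pos in simp)
    then have "((\<lambda>s. ereal (Psi w s)) \<longlongrightarrow> \<infinity>) (at_left T)"
      unfolding tendsto_PInfty_eq_at_top Psi_eq_moment divide_inverse by (simp add: mult.commute)
    ultimately show ?thesis by simp
  qed
qed

text \<open>Treated apart from \<open>Psi_at_inside\<close> because the radius of convergence may be
  0.\<close>

lemma Psi_at_0: "Psi_at w 0 = 0"
proof -
  have "(\<lambda>k. w k * 0 ^ k) sums w 0" by (rule powser_sums_zero)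
  then have "summable (\<lambda>k. w k * 0 ^ k)" "Phi w 0 = w 0" by (auto simp: Phi_def sums_iff)
  moreover have "(\<lambda>k. ereal (real k * w k * 0 ^ k)) = (\<lambda>k. 0)"
  proof
    fix k show "ereal (real k * w k * 0 ^ k) = 0" by (cases k) (auto simp: zero_ereal_def)
  qed
  ultimately show ?thesis using w0 by (simp add: Psi_at_def)
qed

lemma Psi_at_strict_mono:
  assumes "0 \<le> s" "s < t" "ereal t \<le> conv_radius w"
  shows "Psi_at w s < Psi_at w t"
proof -
  have s: "ereal s < conv_radius w" by (rule order.strict_trans2[OF _ assms(3)]) (use assms in simp)
  show ?thesis
  proof (cases "ereal t < conv_radius w")
    case True
    then show ?thesis using Psi_strict_mono[OF assms(1,2)] assms s by (simp add: Psi_at_inside)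
  next
    case False
    then have T: "conv_radius w = ereal t" using assms(3) by simp
    \<comment> \<open>The intermediate point keeps the inequality strict after passing to the limit
      at \<open>t\<close>.\<close>
    obtain s' where s': "s < s'" "s' < t" using dense[OF assms(2)] by blast
    have "ereal (Psi w s') \<le> Psi_at w t"
    proof (rule tendsto_lowerbound[OF Psi_tendsto_Psi_at])
      show "\<forall>\<^sub>F x in at_left t. ereal (Psi w s') \<le> ereal (Psi w x)"
        using eventually_at_left_real[OF s'(2)]
      proof eventually_elim
        case (elim x)
        then show ?case using Psi_strict_mono[of s' x] assms s' T by auto
      qed
    qed (use assms T in auto)
    moreover have "Psi w s < Psi w s'" using s' assms T by (intro Psi_strict_mono) auto
    then have "Psi_at w s < ereal (Psi w s')" using s assms by (simp add: Psi_at_inside)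
    ultimately show ?thesis by (rule order.strict_trans2[rotated])
  qed
qed

text \<open>\<open>Phi w t\<close> grows at least like \<open>t ^ b\<close>, the terms below
  \<open>b\<close> at most like \<open>t ^ (b - 1)\<close>; hence the deficit in
  \<open>Psi_ge\<close> with \<open>B = b\<close> becomes smaller than \<open>b - l\<close>.\<close>

lemma exists_Psi_gt:
  assumes rad: "conv_radius w = \<infinity>" and "0 \<le> l" "l < real b" and wb: "w b > 0"
  obtains t where "0 \<le> t" "l < Psi w t"
proof -
  define C where "C = (\<Sum>k<b. real b * w k)"
  have C: "C \<ge> 0" unfolding C_def using w_nonneg by (intro sum_nonneg) auto
  define t where "t = 1 + C / (w b * (real b - l))"
  have t: "t \<ge> 1" using C wb assms by (simp add: t_def)
  have "C / (w b * (real b - l)) < t" by (simp add: t_def)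
  then have Ct: "C < t * (w b * (real b - l))" using wb assms by (simp add: pos_divide_less_eq)
  have t': "0 \<le> t" "ereal t < conv_radius w" using t rad by auto
  have b: "b \<ge> 1" using assms by (cases b) auto
  have M: "moment 0 t \<ge> w b * t ^ b"
    using sum_le_suminf[of "\<lambda>k. w k * t ^ k" "{b}"] summable_inside(1)[OF t'] w_nonneg t
    by (simp add: moment_def)
  have wbt: "w b * t ^ b > 0" using wb t by simp
  have "(\<Sum>k<b. real b * (w k * t ^ k)) \<le> (\<Sum>k<b. real b * (w k * t ^ (b - 1)))"
    using w_nonneg t by (intro sum_mono mult_left_mono power_increasing) auto
  also have "\<dots> = C * t ^ (b - 1)" by (simp add: C_def sum_distrib_right mult.assoc)
  also have "\<dots> < t * (w b * (real b - l)) * t ^ (b - 1)" using Ct t by (intro mult_strict_right_mono) auto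
  also have "\<dots> = (real b - l) * (w b * t ^ b)" using b by (cases b) (auto simp: mult_ac)
  also have "\<dots> \<le> (real b - l) * moment 0 t" using M assms by (intro mult_left_mono) auto
  finally have "(\<Sum>k<b. real b * (w k * t ^ k)) / moment 0 t < real b - l"
    using M wbt by (simp add: pos_divide_less_eq)
  with Psi_ge[OF t', of b] t' show thesis by (intro that[of t]) auto
qed

text \<open>Monotonicity makes the limit at infinity exist and equal the supremum, so the
  \<open>Lim\<close> in \<open>nu_w\<close> has its intended value.\<close>

lemma Psi_le_nu:
  assumes rad: "conv_radius w = \<infinity>" and "0 \<le> t"
  shows "ereal (Psi w t) \<le> nu_w w"
proof -
  define L where "L = (SUP t\<in>{0..}. ereal (Psi w t))"
  have le: "ereal (Psi w t) \<le> L" if "0 \<le> t" for t using that by (auto simp: L_def intro: SUP_upper)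
  have "((\<lambda>s. ereal (Psi w s)) \<longlongrightarrow> L) at_top"
  proof (rule order_tendstoI)
    fix a assume "a < L"
    then obtain t where t: "0 \<le> t" "a < ereal (Psi w t)" by (auto simp: L_def less_SUP_iff)
    show "\<forall>\<^sub>F s in at_top. a < ereal (Psi w s)"
      using eventually_gt_at_top[of t]
    proof eventually_elim
      case (elim s)
      then have "ereal (Psi w t) < ereal (Psi w s)" using Psi_strict_mono[OF t(1)] rad by simp
      with t(2) show ?case by (rule less_trans)
    qed
  next
    fix a assume "L < a"
    then have "ereal (Psi w s) < a" if "0 \<le> s" for s using le[OF that] by (rule le_less_trans[rotated])
    then show "\<forall>\<^sub>F s in at_top. ereal (Psi w s) < a"
      by (rule eventually_mono[OF eventually_ge_at_top])
  qed
  then have "Lim at_top (\<lambda>s. ereal (Psi w s)) = L" by (intro tendsto_Lim) auto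
  then have "nu_w w = L" using rad by (simp add: nu_w_def)
  then show ?thesis using le assms by simp
qed

lemma exists1_Psi_at_eq:
  assumes l: "0 \<le> l" "l < real b" and wb: "w b > 0" and nu: "ereal l \<le> nu_w w"
  shows "\<exists>!t. 0 \<le> t \<and> ereal t \<le> conv_radius w \<and> Psi_at w t = ereal l"
proof (rule ex_ex1I)
  have inside: "\<exists>s. 0 \<le> s \<and> ereal s \<le> conv_radius w \<and> Psi_at w s = ereal l"
    if t: "0 \<le> t" "ereal t < conv_radius w" "l \<le> Psi w t" for t
  proof -
    obtain s where s: "0 \<le> s" "s \<le> t" "Psi w s = l" using Psi_intermediate[OF t(1,2) l(1) t(3)] by blast
    have "ereal s < conv_radius w" by (rule order.strict_trans1[OF _ t(2)]) (use s in simp)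
    with s show ?thesis by (intro exI[of _ s]) (auto simp: Psi_at_inside)
  qed
  show "\<exists>t. 0 \<le> t \<and> ereal t \<le> conv_radius w \<and> Psi_at w t = ereal l"
  proof (cases "conv_radius w")
    case (real T)
    then have nu_eq: "nu_w w = Psi_at w T" by (simp add: nu_w_def)
    have "T \<ge> 0" using real conv_radius_nonneg[of w] by simp
    show ?thesis
    proof (cases "ereal l = nu_w w")
      case True
      then show ?thesis using real nu_eq \<open>T \<ge> 0\<close> by (intro exI[of _ T]) auto
    next
      case False
      with nu have less: "ereal l < Psi_at w T" using nu_eq by simp
      \<comment> \<open>A radius of 0 would give \<open>l < 0\<close>, as
        \<open>Psi_at w 0 = 0\<close>.\<close>
      have "T \<noteq> 0" using less l Psi_at_0 by (auto simp: zero_ereal_def)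
      with \<open>T \<ge> 0\<close> have "T > 0" by simp
      from order_tendstoD(1)[OF Psi_tendsto_Psi_at[OF this real] less] eventually_at_left_real[OF this]
      have "\<forall>\<^sub>F s in at_left T. l < Psi w s \<and> 0 < s \<and> s < T" by eventually_elim auto
      then obtain s where "l < Psi w s" "0 < s" "s < T"
        using eventually_happens[of _ "at_left T"] by auto
      then show ?thesis using real by (intro inside[of s]) auto
    qed
  next
    case PInf
    then obtain t where "0 \<le> t" "l < Psi w t" using exists_Psi_gt[OF _ l wb] by auto
    then show ?thesis using PInf by (intro inside[of t]) auto
  next
    case MInf
    then show ?thesis using conv_radius_nonneg[of w] by simp
  qed
next
  fix s t
  assume "0 \<le> s \<and> ereal s \<le> conv_radius w \<and> Psi_at w s = ereal l"
    "0 \<le> t \<and> ereal t \<le> conv_radius w \<and> Psi_at w t = ereal l"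
  then show "s = t" using Psi_at_strict_mono[of s t] Psi_at_strict_mono[of t s] by (cases s t rule: linorder_cases) auto
qed

text \<open>Inside the disc this is the derivative formula. At a positive radius the formula passes
  to the left limit; the second moment may be infinite there, and then both sides are.\<close>

lemma variance_eq:
  assumes "0 \<le> t" "ereal t \<le> conv_radius w"
    and sm0: "summable (\<lambda>k. w k * t ^ k)" and sm1: "summable (\<lambda>k. real k * w k * t ^ k)"
  shows "(\<Sum>k. ereal ((real k - Psi w t)\<^sup>2 * (w k * t ^ k / Phi w t))) = ereal t * PsiD w t"
proof -
  have pos: "moment 0 t > 0" by (rule moment_0_pos[OF sm0 assms(1)])
  have finite_case: "(\<Sum>k. ereal ((real k - Psi w t)\<^sup>2 * (w k * t ^ k / Phi w t))) = ereal (moment 2 t / moment 0 t - (Psi w t)\<^sup>2)"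
    if sm2: "summable (\<lambda>k. (real k)\<^sup>2 * w k * t ^ k)"
  proof -
    have "(\<lambda>k. (real k - Psi w t)\<^sup>2 * (w k * t ^ k) / moment 0 t) sums (moment 0 t * (moment 2 t / moment 0 t - (Psi w t)\<^sup>2) / moment 0 t)"
      by (intro sums_divide variance_sums sm0 sm1 sm2 assms)
    then have "(\<lambda>k. (real k - Psi w t)\<^sup>2 * (w k * t ^ k / Phi w t)) sums (moment 2 t / moment 0 t - (Psi w t)\<^sup>2)"
      using pos by (simp add: Phi_eq_moment)
    from sums_ereal[THEN iffD2, OF this] show ?thesis by (simp add: sums_iff)
  qed
  consider "ereal t < conv_radius w" | "t = 0" | "0 < t" "conv_radius w = ereal t"
    using assms by fastforce
  then show ?thesis
  proof cases
    case 1
    then show ?thesis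
      using finite_case summable_inside(3)[OF assms(1)] DERIV_Psi(2)[OF assms(1)] by (simp add: PsiD_def)
  next
    case 2
    \<comment> \<open>All mass sits at 0, and the right-hand side is 0 whatever the value of
      \<open>PsiD\<close>; this includes a radius equal to 0.\<close>
    have "Psi w 0 = 0" by (simp add: Psi_eq_moment moment_def)
    then have "(\<lambda>k. ereal ((real k - Psi w t)\<^sup>2 * (w k * t ^ k / Phi w t))) = (\<lambda>k. 0)"
      using 2 by (auto simp: fun_eq_iff power_0_left zero_ereal_def)
    then show ?thesis using 2 by (simp add: zero_ereal_def[symmetric])
  next
    case 3
    have lim0: "(moment 0 \<longlongrightarrow> moment 0 t) (at_left t)" and lim1: "(moment 1 \<longlongrightarrow> moment 1 t) (at_left t)"
      using moment_tendsto_at_left[OF 3(1), of 0] moment_tendsto_at_left[OF 3(1), of 1] sm0 sm1 by simp_all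
    then have limPsi: "(Psi w \<longlongrightarrow> Psi w t) (at_left t)"
      unfolding Psi_eq_moment[abs_def] using pos by (intro tendsto_divide) auto
    have deriv_eq: "\<forall>\<^sub>F s in at_left t. (moment 2 s / moment 0 s - (Psi w s)\<^sup>2) / s = deriv (Psi w) s"
      using eventually_at_left_real[OF 3(1)]
    proof eventually_elim
      case (elim s)
      then show ?case using DERIV_Psi(2)[of s] 3(2) by (simp add: field_simps)
    qed
    have PsiD: "PsiD w t = L" if "((\<lambda>s. ereal ((moment 2 s / moment 0 s - (Psi w s)\<^sup>2) / s)) \<longlongrightarrow> L) (at_left t)" for L
    proof -
      have "((\<lambda>s. ereal (deriv (Psi w) s)) \<longlongrightarrow> L) (at_left t)"
        by (rule Lim_transform_eventually[OF that]) (use deriv_eq in \<open>eventually_elim, simp\<close>)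
      then show ?thesis using tendsto_Lim[of "at_left t"] 3(2) by (simp add: PsiD_def)
    qed
    show ?thesis
    proof (cases "summable (\<lambda>k. (real k)\<^sup>2 * w k * t ^ k)")
      case True
      have "((\<lambda>s. ereal ((moment 2 s / moment 0 s - (Psi w s)\<^sup>2) / s))
          \<longlongrightarrow> ereal ((moment 2 t / moment 0 t - (Psi w t)\<^sup>2) / t)) (at_left t)"
        using moment_tendsto_at_left[OF 3(1) True] lim0 limPsi pos 3(1)
        by (intro tendsto_intros) auto
      from PsiD[OF this] show ?thesis using finite_case[OF True] 3(1) by simp
    next
      case False
      have "filterlim (\<lambda>s. (- (Psi w s)\<^sup>2 + inverse (moment 0 s) * moment 2 s)) at_top (at_left t)"
      proof (rule filterlim_tendsto_add_at_top)
        show "((\<lambda>s. - (Psi w s)\<^sup>2) \<longlongrightarrow> - (Psi w t)\<^sup>2) (at_left t)" by (intro tendsto_intros limPsi)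
        show "filterlim (\<lambda>s. inverse (moment 0 s) * moment 2 s) at_top (at_left t)"
        proof (rule filterlim_tendsto_pos_mult_at_top)
          show "((\<lambda>s. inverse (moment 0 s)) \<longlongrightarrow> inverse (moment 0 t)) (at_left t)"
            using lim0 pos by (intro tendsto_inverse) auto
          show "filterlim (moment 2) at_top (at_left t)"
            by (rule moment_at_top_at_left[OF 3 False])
        qed (use pos in simp)
      qed
      moreover have "((\<lambda>s. inverse s) \<longlongrightarrow> inverse t) (at_left t)"
        using 3(1) by (intro tendsto_intros) auto
      ultimately have "filterlim (\<lambda>s. inverse s * (- (Psi w s)\<^sup>2 + inverse (moment 0 s) * moment 2 s)) at_top (at_left t)"
        using 3(1) by (intro filterlim_tendsto_pos_mult_at_top[of _ "inverse t"]) auto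
      then have "((\<lambda>s. ereal ((moment 2 s / moment 0 s - (Psi w s)\<^sup>2) / s)) \<longlongrightarrow> \<infinity>) (at_left t)"
        unfolding tendsto_PInfty_eq_at_top by (simp add: divide_inverse mult_ac)
      from PsiD[OF this] have "ereal t * PsiD w t = \<infinity>" using 3(1) by simp
      moreover have "(\<Sum>k. ereal ((real k - Psi w t)\<^sup>2 * (w k * t ^ k / Phi w t))) = \<infinity>"
      proof (rule suminf_ereal_eq_infinity)
        show "0 \<le> (real k - Psi w t)\<^sup>2 * (w k * t ^ k / Phi w t)" for k
          using w_nonneg[of k] assms(1) pos by (simp add: Phi_eq_moment)
        show "\<not> summable (\<lambda>k. (real k - Psi w t)\<^sup>2 * (w k * t ^ k / Phi w t))"
        proof
          assume "summable (\<lambda>k. (real k - Psi w t)\<^sup>2 * (w k * t ^ k / Phi w t))"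
          from summable_mult[OF this, of "Phi w t"]
          have "summable (\<lambda>k. (real k - Psi w t)\<^sup>2 * (w k * t ^ k))" using pos by (simp add: Phi_eq_moment)
          \<comment> \<open>Restoring the finite lower moments would make the second moment
            finite.\<close>
          then have "summable (\<lambda>k. (real k - Psi w t)\<^sup>2 * (w k * t ^ k) + 2 * Psi w t * (real k * w k * t ^ k) - (Psi w t)\<^sup>2 * (w k * t ^ k))"
            by (intro summable_add summable_diff summable_mult sm0 sm1)
          also have "(\<lambda>k. (real k - Psi w t)\<^sup>2 * (w k * t ^ k) + 2 * Psi w t * (real k * w k * t ^ k) - (Psi w t)\<^sup>2 * (w k * t ^ k))
            = (\<lambda>k. (real k)\<^sup>2 * w k * t ^ k)"
            by (auto simp: fun_eq_iff power2_eq_square algebra_simps)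
          finally show False using False by simp
        qed
      qed
      ultimately show ?thesis by (simp only:)
    qed
  qed
qed

text \<open>Divergence of \<open>Phi w\<close> at \<open>t\<close> can occur only at the radius and
  forces the value \<open>\<infinity>\<close>, as does divergence of the numerator; a finite value
  excludes both.\<close>

lemma Psi_at_finite:
  assumes t: "0 \<le> t" "ereal t \<le> conv_radius w" and fin: "Psi_at w t \<noteq> \<infinity>"
  shows "summable (\<lambda>k. w k * t ^ k)" "summable (\<lambda>k. real k * w k * t ^ k)" "Psi_at w t = ereal (Psi w t)"
proof -
  show sm0: "summable (\<lambda>k. w k * t ^ k)"
  proof (rule ccontr)
    assume ns: "\<not> summable (\<lambda>k. w k * t ^ k)"
    then have "\<not> ereal t < conv_radius w" using summable_inside(1)[OF t(1)] by blast
    then have "conv_radius w = ereal t" using t(2) by simp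
    moreover have "t \<noteq> 0" using ns powser_sums_zero[of w] by (auto simp: sums_iff)
    ultimately show False using Psi_at_not_summable[of t] ns t(1) fin by simp
  qed
  have pos: "moment 0 t > 0" by (rule moment_0_pos[OF sm0 t(1)])
  show sm1: "summable (\<lambda>k. real k * w k * t ^ k)"
  proof (rule ccontr)
    assume "\<not> summable (\<lambda>k. real k * w k * t ^ k)"
    then have "(\<Sum>k. ereal (real k * w k * t ^ k)) = \<infinity>"
      using t(1) w_nonneg by (intro suminf_ereal_eq_infinity) auto
    then show False using sm0 pos fin by (simp add: Psi_at_def Phi_eq_moment)
  qed
  have "(\<Sum>k. ereal (real k * w k * t ^ k)) = ereal (moment 1 t)"
    using sums_ereal[THEN iffD2, OF summable_sums[OF sm1]] by (simp add: moment_def sums_iff)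
  then show "Psi_at w t = ereal (Psi w t)"
    using sm0 pos by (simp add: Psi_at_def Phi_eq_moment Psi_eq_moment)
qed

text \<open>Cases (i) and (ii) are merged into \<open>t_l\<close>: either the mean is
  \<open>l\<close>, or it is smaller and \<open>t\<close> is the radius. For \<open>t > 0\<close>
  these are the two alternatives under which truncation and tilting work.\<close>

lemma Ncount_converges_in_probability:
  assumes t: "0 \<le> t" "ereal t \<le> conv_radius w"
    and m_lim: "(\<lambda>n. real (m n) / real n) \<longlonglongrightarrow> l"
    and l: "0 \<le> l" "l < real b" and wb: "w b > 0"
    and t_l: "Psi_at w t = ereal l \<or> Psi_at w t < ereal l \<and> conv_radius w = ereal t"
    and pos: "\<epsilon> > 0" "\<delta> > 0"
  shows "\<forall>\<^sub>F n in sequentially. Zmn w (m n) n > 0 \<longrightarrow>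
     prob_BB w (m n) n (\<lambda>y. \<bar>real (Ncount n k y) / real n - w k * t ^ k / Phi w t\<bar> > \<epsilon>) < \<delta>"
proof (cases "t = 0")
  case True
  have "Phi w 0 = w 0" using powser_sums_zero[of w] by (auto simp: Phi_def sums_iff)
  then have \<pi>: "w k * t ^ k / Phi w t = (if k = 0 then 1 else 0)" using True w0 by auto
  have "\<forall>\<^sub>F n in sequentially. Zmn w (m n) n > 0 \<longrightarrow>
      prob_BB w (m n) n (\<lambda>y. real (Ncount n k y) > \<epsilon> * real n) < \<delta>"
    if k: "k \<ge> 1" "\<epsilon> > 0" "\<delta> > 0" for k \<epsilon> \<delta>
  proof (cases "l = 0")
    case True
    then show ?thesis using Ncount_small_if_few_balls[of m k \<epsilon> \<delta> w] m_lim k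
      by (auto elim: eventually_mono)
  next
    case False
    \<comment> \<open>Here \<open>Psi_at w 0 = 0 < l\<close>, so only the second alternative of
      \<open>t_l\<close> remains.\<close>
    then have "conv_radius w = 0" using t_l \<open>t = 0\<close> l Psi_at_0 by (auto simp: zero_ereal_def)
    then show ?thesis using k by (intro Ncount_small_if_conv_radius_0 w_nonneg w0)
  qed
  from Ncount_concentration_dirac[OF w_nonneg m_lim this pos] show ?thesis unfolding \<pi> by simp
next
  case False
  with t have t0: "t > 0" by simp
  have "Psi_at w t \<noteq> \<infinity>" using t_l by auto
  note fin = Psi_at_finite[OF t this]
  have M: "moment 0 t > 0" by (rule moment_0_pos[OF fin(1) t(1)])
  have "0 < Psi_at w t" using Psi_at_strict_mono[OF _ t0 t(2)] Psi_at_0 by simp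
  then have l0: "l > 0" using t_l l fin(3) by (auto simp: zero_ereal_def)
  define p where "p = (\<lambda>k. w k * t ^ k / Phi w t)"
  have p_alt: "p = (\<lambda>k. 1 / Phi w t * w k * t ^ k)" by (simp add: p_def)
  have p_nn: "p k \<ge> 0" for k using w_nonneg[of k] t M by (simp add: p_def Phi_eq_moment)
  have "(\<lambda>k. w k * t ^ k / Phi w t) sums (Phi w t / Phi w t)"
    unfolding Phi_def by (intro sums_divide summable_sums fin)
  then have p1: "p sums 1" using M by (simp add: p_def Phi_eq_moment)
  have "(\<lambda>k. real k * w k * t ^ k / Phi w t) sums Psi w t"
    unfolding Psi_def by (intro sums_divide summable_sums fin)
  then have mean: "(\<lambda>k. real k * p k) sums Psi w t" by (simp add: p_def mult.assoc)
  have p0: "p 0 > 0" "p b > 0" using w0 wb t0 M by (auto simp: p_def Phi_eq_moment)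
  have dich: "Psi w t = l \<or> Psi w t < l \<and> (\<forall>u>0. \<not> summable (\<lambda>k. p k * exp (real k * u)))"
  proof (cases "Psi w t = l")
    case False
    with t_l fin(3) have less: "Psi w t < l" "conv_radius w = ereal t" by auto
    have "\<not> summable (\<lambda>k. p k * exp (real k * u))" if u: "u > 0" for u
    proof
      assume "summable (\<lambda>k. p k * exp (real k * u))"
      from summable_mult[OF this, of "Phi w t"] have "summable (\<lambda>k. w k * (t * exp u) ^ k)"
        using M by (simp add: p_def Phi_eq_moment power_mult_distrib exp_of_nat2_mult mult_ac)
      \<comment> \<open>An exponential moment would mean convergence at \<open>t * exp u\<close>,
        beyond the radius \<open>t\<close>.\<close>
      from conv_radius_geI[OF this] less have "t * exp u \<le> t" using t0 by simp
      then show False using t0 u by simp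
    qed
    with less show ?thesis by blast
  qed simp
  have lower: "\<forall>\<^sub>F n in sequentially. Zmn p (m n) n > 0 \<longrightarrow> exp (- \<eta> * real n) \<le> Zmn p (m n) n" if "\<eta> > 0" for \<eta>
  proof (rule Zmn_subexponential_lower_bound[OF p_nn p0(1) l0 l(2) p0(2) _ m_lim that])
    fix \<eta>' :: real assume "\<eta>' > 0"
    then show "\<exists>K\<ge>b. \<forall>u. 1 - \<eta>' \<le> (\<Sum>k\<le>K. p k * exp ((real k - l) * u))"
      by (rule truncated_exp_moment_ge[OF p_nn p1 p0(1) l0 l(2) p0(2) mean dich])
  qed
  have "Zmn p (m n) n > 0 \<longleftrightarrow> Zmn w (m n) n > 0" for n
  proof -
    have "(1 / Phi w t) ^ n * t ^ m n > 0" using t0 M by (simp add: Phi_eq_moment)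
    then show ?thesis unfolding p_alt Zmn_tilt by (metis mult_zero_right mult_less_cancel_left_pos)
  qed
  moreover have "prob_BB p (m n) n P = prob_BB w (m n) n P" for n P
    unfolding p_alt using t0 M by (intro prob_BB_tilt) (auto simp: Phi_eq_moment)
  ultimately show ?thesis
    using Ncount_concentration[OF p_nn p1 lower pos, of k] by (simp add: p_def)
qed

end

theorem theorem10p4:
  fixes w :: "nat \<Rightarrow> real" and m :: "nat \<Rightarrow> nat" and l :: real
  assumes w_nonneg: "\<And>k. w k \<ge> 0"
    and w0: "w 0 > 0"
    and wk: "\<exists>k\<ge>1. w k > 0"
    and m_lim: "(\<lambda>n. real (m n) / real n) \<longlonglongrightarrow> l"
    and l_nonneg: "0 \<le> l"
    and l_omega: "ereal l < omega_w w"
  shows "(ereal l \<le> nu_w w \<longrightarrow>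
            (\<exists>!t. 0 \<le> t \<and> ereal t \<le> conv_radius w \<and> Psi_at w t = ereal l))
       \<and> (nu_w w < ereal l \<longrightarrow> conv_radius w < \<infinity>)
       \<and> (\<forall>\<tau>::real.
            ((ereal l \<le> nu_w w \<and> 0 \<le> \<tau> \<and> ereal \<tau> \<le> conv_radius w \<and> Psi_at w \<tau> = ereal l)
             \<or> (nu_w w < ereal l \<and> ereal \<tau> = conv_radius w))
          \<longrightarrow>
            (let \<pi> = (\<lambda>k. w k * \<tau> ^ k / Phi w \<tau>); \<mu> = real_of_ereal (Psi_at w \<tau>) in
              0 \<le> \<tau>
            \<and> summable (\<lambda>k. w k * \<tau> ^ k) \<and> 0 < Phi w \<tau>
            \<and> (\<forall>k. 0 \<le> \<pi> k) \<and> \<pi> sums 1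
            \<and> Psi_at w \<tau> = min (ereal l) (nu_w w)
            \<and> (\<lambda>k. real k * \<pi> k) sums \<mu>
            \<and> (\<Sum>k. ereal ((real k - \<mu>)\<^sup>2 * \<pi> k)) = ereal \<tau> * PsiD w \<tau>
            \<and> (\<forall>k \<epsilon> \<delta>. \<epsilon> > 0 \<longrightarrow> \<delta> > 0 \<longrightarrow>
                 (\<exists>N. \<forall>n\<ge>N. Zmn w (m n) n > 0 \<longrightarrow>
                    prob_BB w (m n) n
                      (\<lambda>y. \<bar>real (Ncount n k y) / real n - \<pi> k\<bar> > \<epsilon>) < \<delta>))))"
proof -
  interpret weight_seq w by unfold_locales (use w_nonneg w0 wk in auto)
  \<comment> \<open>Since \<open>l\<close> lies below the supremum of the support, some positive
    weight has an index above \<open>l\<close>.\<close>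
  obtain b where b: "w b > 0" "l < real b"
    using l_omega unfolding omega_w_def by (auto simp: less_SUP_iff)
  have ex1: "\<exists>!t. 0 \<le> t \<and> ereal t \<le> conv_radius w \<and> Psi_at w t = ereal l" if "ereal l \<le> nu_w w"
    by (rule exists1_Psi_at_eq[OF l_nonneg b(2,1) that])
  have radius: "conv_radius w < \<infinity>" if "nu_w w < ereal l"
  proof (rule ccontr)
    assume "\<not> ?thesis"
    then have rad: "conv_radius w = \<infinity>" by simp
    obtain t where t: "0 \<le> t" "l < Psi w t" using exists_Psi_gt[OF rad l_nonneg b(2,1)] .
    have "ereal (Psi w t) < ereal l" using Psi_le_nu[OF rad t(1)] that by (rule order.strict_trans1)
    with t show False by simp
  qed
  have main: "let \<pi> = (\<lambda>k. w k * \<tau> ^ k / Phi w \<tau>); \<mu> = real_of_ereal (Psi_at w \<tau>) in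
              0 \<le> \<tau>
            \<and> summable (\<lambda>k. w k * \<tau> ^ k) \<and> 0 < Phi w \<tau>
            \<and> (\<forall>k. 0 \<le> \<pi> k) \<and> \<pi> sums 1
            \<and> Psi_at w \<tau> = min (ereal l) (nu_w w)
            \<and> (\<lambda>k. real k * \<pi> k) sums \<mu>
            \<and> (\<Sum>k. ereal ((real k - \<mu>)\<^sup>2 * \<pi> k)) = ereal \<tau> * PsiD w \<tau>
            \<and> (\<forall>k \<epsilon> \<delta>. \<epsilon> > 0 \<longrightarrow> \<delta> > 0 \<longrightarrow>
                 (\<exists>N. \<forall>n\<ge>N. Zmn w (m n) n > 0 \<longrightarrow>
                    prob_BB w (m n) n
                      (\<lambda>y. \<bar>real (Ncount n k y) / real n - \<pi> k\<bar> > \<epsilon>) < \<delta>))"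
    if \<tau>: "(ereal l \<le> nu_w w \<and> 0 \<le> \<tau> \<and> ereal \<tau> \<le> conv_radius w \<and> Psi_at w \<tau> = ereal l)
             \<or> (nu_w w < ereal l \<and> ereal \<tau> = conv_radius w)" for \<tau>
  proof -
    have t: "0 \<le> \<tau>" "ereal \<tau> \<le> conv_radius w"
      using \<tau> conv_radius_nonneg[of w] by (auto simp: zero_ereal_def dest: sym)
    have nu_eq: "nu_w w = Psi_at w \<tau>" if "ereal \<tau> = conv_radius w"
      unfolding nu_w_def that[symmetric] by simp
    have t_min: "Psi_at w \<tau> = min (ereal l) (nu_w w)"
      using \<tau> nu_eq by (auto simp: min_def)
    \<comment> \<open>In case (ii) \<open>\<tau>\<close> is the radius, where \<open>Psi_at\<close>
      equals \<open>nu_w\<close>, which is below \<open>l\<close>.\<close>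
    have t_l: "Psi_at w \<tau> = ereal l \<or> Psi_at w \<tau> < ereal l \<and> conv_radius w = ereal \<tau>"
      using \<tau> nu_eq by auto
    have "Psi_at w \<tau> \<noteq> \<infinity>" using t_l by auto
    note fin = Psi_at_finite[OF t this]
    have Phi_pos: "Phi w \<tau> > 0" using moment_0_pos[OF fin(1) t(1)] by (simp add: Phi_eq_moment)
    have "(\<lambda>k. w k * \<tau> ^ k / Phi w \<tau>) sums (Phi w \<tau> / Phi w \<tau>)"
      unfolding Phi_def by (intro sums_divide summable_sums fin)
    then have total: "(\<lambda>k. w k * \<tau> ^ k / Phi w \<tau>) sums 1" using Phi_pos by simp
    have "(\<lambda>k. real k * w k * \<tau> ^ k / Phi w \<tau>) sums Psi w \<tau>"
      unfolding Psi_def by (intro sums_divide summable_sums fin)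
    then have mean: "(\<lambda>k. real k * (w k * \<tau> ^ k / Phi w \<tau>)) sums Psi w \<tau>" by (simp add: mult.assoc)
    have nonneg: "0 \<le> w k * \<tau> ^ k / Phi w \<tau>" for k using w_nonneg[of k] t Phi_pos by simp
    have conv: "\<exists>N. \<forall>n\<ge>N. Zmn w (m n) n > 0 \<longrightarrow> prob_BB w (m n) n
         (\<lambda>y. \<bar>real (Ncount n k y) / real n - w k * \<tau> ^ k / Phi w \<tau>\<bar> > \<epsilon>) < \<delta>"
      if "\<epsilon> > 0" "\<delta> > 0" for k \<epsilon> \<delta>
      using Ncount_converges_in_probability[OF t m_lim l_nonneg b(2,1) t_l that]
      unfolding eventually_sequentially .
    show ?thesis
      unfolding Let_def fin(3) real_of_ereal.simps
      using t(1) fin(1) Phi_pos nonneg total t_min[unfolded fin(3)] mean variance_eq[OF t fin(1,2)] conv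
      by (intro conjI allI impI)
  qed
  show ?thesis using ex1 radius main by blast
qed

end
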